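(* Let $G$ be a countable sofic group that contains a nonabelian free subgroup. Let $(K,\kappa)$ be a standard Borel probability space with $H(\kappa)=+\infty$. Then the Bernoulli shift $(G,K^G,\kappa^G)$ does not have a generating partition of finite entropy.
   Context: A countable group $G$ is sofic if there is a sequence of maps $\sigma_i:G\to\mathrm{Sym}(m_i)$ (not necessarily homomorphisms) and finite sets $F_1\subset F_2\subset\cdots$ with $\bigcup_iF_i=G$ and $\epsilon_i\to0$ such that for each $i$ the set of $v\in\{1,\dots,m_i\}$ with $\sigma_i(f_1)\sigma_i(f_2)v=\sigma_i(f_1f_2)v$ for all $f_1,f_2\in F_i$ and $\sigma_i(f_1)v\neq\sigma_i(f_2)v$ for distinct $f_1,f_2\in F_i$ has at least $(1-\epsilon_i)m_i$ elements. The Bernoulli shift $(G,K^G,\kappa^G)$ is the action $(gx)(f)=x(g^{-1}f)$ on $K^G$ with product measure. $H(\kappa)=-\sum_k\kappa(\{k\})\log\kappa(\{k\})$ if $\kappa$ is supported on a countable set, else $+\infty$. A partition means a measurable partition into at most countably many sets; its entropy is $H(\alpha)=-\sum_{A\in\alpha}\mu(A)\log\mu(A)$. A partition $\alpha$ is generating if every measurable set agrees up to a null set with a set in the smallest $G$-invariant $\sigma$-algebra containing the atoms of $\alpha$. *)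

theory Defs
  imports "HOL-Probability.Probability" "HOL-Combinatorics.Permutations"
begin

definition sofic_good_set ::
  "('g::group_add \<Rightarrow> nat \<Rightarrow> nat) \<Rightarrow> nat \<Rightarrow> 'g set \<Rightarrow> nat set" where
  "sofic_good_set s m F = {v \<in> {..<m}.
      (\<forall>f1\<in>F. \<forall>f2\<in>F. s f1 (s f2 v) = s (f1 + f2) v) \<and>
      (\<forall>f1\<in>F. \<forall>f2\<in>F. f1 \<noteq> f2 \<longrightarrow> s f1 v \<noteq> s f2 v)}"

definition sofic :: "'g::group_add itself \<Rightarrow> bool" where
  "sofic _ \<longleftrightarrow> (\<exists>(m :: nat \<Rightarrow> nat) (\<sigma> :: nat \<Rightarrow> 'g \<Rightarrow> nat \<Rightarrow> nat)
       (F :: nat \<Rightarrow> 'g set) (\<epsilon> :: nat \<Rightarrow> real).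
      (\<forall>i. 0 < m i) \<and>
      (\<forall>i g. \<sigma> i g permutes {..<m i}) \<and>
      (\<forall>i. finite (F i)) \<and> (\<forall>i. F i \<subseteq> F (Suc i)) \<and> (\<Union>i. F i) = UNIV \<and>
      \<epsilon> \<longlonglongrightarrow> 0 \<and>
      (\<forall>i. real (card (sofic_good_set (\<sigma> i) (m i) (F i))) \<ge> (1 - \<epsilon> i) * real (m i)))"

text \<open>A word in the letters a, b and their inverses: (True,_) is a, (False,_) is b;
  the second component True means the letter itself, False its inverse.\<close>

definition reduced_word :: "(bool \<times> bool) list \<Rightarrow> bool" where
  "reduced_word w \<longleftrightarrow> (\<forall>i. Suc i < length w \<longrightarrow>
      \<not> (fst (w ! i) = fst (w ! Suc i) \<and> snd (w ! i) \<noteq> snd (w ! Suc i)))"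

definition eval_word :: "'g::group_add \<Rightarrow> 'g \<Rightarrow> (bool \<times> bool) list \<Rightarrow> 'g" where
  "eval_word a b w = sum_list (map (\<lambda>(x, s). let g = (if x then a else b) in
                                     if s then g else - g) w)"

definition free_pair :: "'g::group_add \<Rightarrow> 'g \<Rightarrow> bool" where
  "free_pair a b \<longleftrightarrow> (\<forall>w. w \<noteq> [] \<and> reduced_word w \<longrightarrow> eval_word a b w \<noteq> 0)"

definition has_nonabelian_free_subgroup :: "'g::group_add itself \<Rightarrow> bool" where
  "has_nonabelian_free_subgroup _ \<longleftrightarrow> (\<exists>a b :: 'g. free_pair a b)"

definition measure_entropy :: "'k measure \<Rightarrow> ennreal" where
  "measure_entropy \<kappa> =
     (if \<exists>C. countable C \<and> C \<in> sets \<kappa> \<and> emeasure \<kappa> C = 1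
      then (\<integral>\<^sup>+ k. ennreal (- measure \<kappa> {k} * ln (measure \<kappa> {k})) \<partial>count_space UNIV)
      else \<infinity>)"

definition bernoulli :: "'g set \<Rightarrow> 'k measure \<Rightarrow> ('g \<Rightarrow> 'k) measure" where
  "bernoulli G \<kappa> = PiM G (\<lambda>_. \<kappa>)"

definition shift :: "'g::group_add \<Rightarrow> ('g \<Rightarrow> 'k) \<Rightarrow> ('g \<Rightarrow> 'k)" where
  "shift g x = (\<lambda>f. x (- g + f))"

definition is_partition :: "'a measure \<Rightarrow> 'a set set \<Rightarrow> bool" where
  "is_partition M \<alpha> \<longleftrightarrow> countable \<alpha> \<and> \<alpha> \<subseteq> sets M \<and> disjoint \<alpha> \<and> \<Union>\<alpha> = space M"

definition partition_entropy :: "'a measure \<Rightarrow> 'a set set \<Rightarrow> ennreal" where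
  "partition_entropy M \<alpha> =
     (\<integral>\<^sup>+ A. ennreal (- measure M A * ln (measure M A)) \<partial>count_space \<alpha>)"

definition invariant_generated :: "'a measure \<Rightarrow> ('g \<Rightarrow> 'a \<Rightarrow> 'a) \<Rightarrow> 'a set set \<Rightarrow> 'a set set" where
  "invariant_generated M act \<alpha> = sigma_sets (space M) {act g ` A | g A. A \<in> \<alpha>}"

definition generating :: "'a measure \<Rightarrow> ('g \<Rightarrow> 'a \<Rightarrow> 'a) \<Rightarrow> 'a set set \<Rightarrow> bool" where
  "generating M act \<alpha> \<longleftrightarrow>
     (\<forall>B\<in>sets M. \<exists>C\<in>invariant_generated M act \<alpha>. (B - C) \<union> (C - B) \<in> null_sets M)"

end

theory Submission
  imports Defs
begin

text \<open>
  The proof is a source coding argument on a sofic approximation. Suppose a partition \<open>\<alpha>\<close> of finite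
  entropy generates. Pick a finite partition \<open>\<beta>\<close> of the base whose entropy exceeds that of \<open>\<alpha>\<close> by a
  large constant. As \<open>\<alpha>\<close> generates, \<open>\<beta>\<close> at the identity is recovered, up to a small error, from
  finitely many translates of a finite coarsening of \<open>\<alpha>\<close>, and that coarsening is in turn close to a
  labelling \<open>a\<close> which looks at finitely many coordinates only. Such local rules make sense on a sofic
  approximation with \<open>m\<close> vertices carrying independent labels of law \<open>\<kappa>\<close>, where good vertices see the
  same statistics as the Bernoulli shift. The \<open>m\<close> values of \<open>\<beta>\<close> are independent, so they carry
  entropy \<open>m H(\<beta>)\<close>; but they can be decoded from the labels \<open>a\<close>, which can be encoded at a cost of
  about \<open>m H(\<alpha>)\<close>, with few errors. This is a contradiction.
\<close>

section \<open>Approximation by finitely determined sets and functions\<close>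

text \<open>The sets that can be approximated by sets respecting one relation of the family are
  closed under complements and countable unions: a countable union is nearly exhausted by finitely
  many of its members, and directedness merges their relations into one.\<close>

lemma directed_approx_set:
  fixes \<R> :: "('a \<Rightarrow> 'a \<Rightarrow> bool) set"
  assumes "finite_measure M" and sp: "space M = UNIV"
    and ne: "\<R> \<noteq> {}"
    and dir: "\<And>R S. R \<in> \<R> \<Longrightarrow> S \<in> \<R> \<Longrightarrow> \<exists>Q\<in>\<R>. Q \<le> R \<and> Q \<le> S"
    and gen: "\<G> \<subseteq> sets M"
    and det: "\<And>B. B \<in> \<G> \<Longrightarrow> \<exists>R\<in>\<R>. \<forall>x y. R x y \<longrightarrow> (x \<in> B \<longleftrightarrow> y \<in> B)"
    and D: "D \<in> sigma_sets UNIV \<G>" and e: "(e::real) > 0"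
  shows "\<exists>C\<in>sets M. \<exists>R\<in>\<R>. (\<forall>x y. R x y \<longrightarrow> (x \<in> C \<longleftrightarrow> y \<in> C)) \<and>
           measure M ((D - C) \<union> (C - D)) < e"
proof -
  interpret finite_measure M by fact
  have UM: "UNIV \<in> sets M" using sets.top[of M] sp by simp
  have inM: "X \<in> sets M" if "X \<in> sigma_sets UNIV \<G>" for X
    using that sets.sigma_sets_subset[OF gen] sp by auto
  show ?thesis using D e
  proof (induction arbitrary: e rule: sigma_sets.induct)
    case (Basic a)
    then obtain R where "R\<in>\<R>" "\<forall>x y. R x y \<longrightarrow> (x \<in> a \<longleftrightarrow> y \<in> a)" using det by blast
    then show ?case using Basic gen by (intro bexI[of _ a] bexI[of _ R]) auto
  next
    case Empty
    then show ?case using ne by (intro bexI[of _ "{}"]) auto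
  next
    case (Compl a)
    then obtain C R where C: "C \<in> sets M" "R \<in> \<R>" "\<forall>x y. R x y \<longrightarrow> (x \<in> C \<longleftrightarrow> y \<in> C)"
      "measure M ((a - C) \<union> (C - a)) < e" by blast
    have "(UNIV - a - (UNIV - C)) \<union> (UNIV - C - (UNIV - a)) = (a - C) \<union> (C - a)" by auto
    then show ?case using C UM
      by (intro bexI[of _ "UNIV - C"] bexI[of _ R]) auto
  next
    case (Union a)
    \<comment> \<open>The errors \<open>d i\<close> sum to at most \<open>e / 2\<close>; the other
      half is spent on cutting the union off at \<open>n\<close>.\<close>
    define d :: "nat \<Rightarrow> real" where "d i = e / 2 * (1/2) ^ Suc i" for i
    have d: "d i > 0" for i using \<open>e > 0\<close> by (simp add: d_def)
    have "\<forall>i. \<exists>C R. C \<in> sets M \<and> R \<in> \<R> \<and> (\<forall>x y. R x y \<longrightarrow> (x \<in> C \<longleftrightarrow> y \<in> C)) \<and>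
           measure M ((a i - C) \<union> (C - a i)) < d i" using Union.IH d by blast
    then obtain C R where C: "\<And>i. C i \<in> sets M" "\<And>i. R i \<in> \<R>"
      "\<And>i x y. R i x y \<Longrightarrow> (x \<in> C i \<longleftrightarrow> y \<in> C i)"
      "\<And>i. measure M ((a i - C i) \<union> (C i - a i)) < d i" by metis
    have aM: "a i \<in> sets M" for i using Union.hyps inM by blast
    have "(\<lambda>n. measure M (\<Union>i<n. a i)) \<longlonglongrightarrow> measure M (\<Union>n. \<Union>i<n. a i)"
      using aM by (intro finite_Lim_measure_incseq) (auto simp: incseq_def, meson lessThan_iff less_le_trans)
    also have "(\<Union>n. \<Union>i<n. a i) = (\<Union>i. a i)" by auto
    finally have "\<forall>\<^sub>F n in sequentially. measure M (\<Union>i<n. a i) > measure M (\<Union>i. a i) - e/2"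
      using \<open>e > 0\<close> by (intro order_tendstoD(1)) auto
    then obtain n where n: "measure M (\<Union>i<n. a i) > measure M (\<Union>i. a i) - e/2"
      by (auto simp: eventually_sequentially)
    have "\<exists>Q\<in>\<R>. \<forall>i<n. Q \<le> R i" for n
    proof (induction n)
      case 0 then show ?case using ne by auto
    next
      case (Suc n)
      then obtain Q where "Q\<in>\<R>" "\<forall>i<n. Q \<le> R i" by blast
      moreover from dir[OF this(1) C(2)[of n]] obtain S where "S\<in>\<R>" "S \<le> Q" "S \<le> R n" by blast
      ultimately show ?case by (intro bexI[of _ S]) (auto simp: less_Suc_eq intro: order_trans)
    qed
    then obtain Q where Q: "Q\<in>\<R>" "\<And>i. i < n \<Longrightarrow> Q \<le> R i" by blast
    have Qd: "\<forall>x y. Q x y \<longrightarrow> (x \<in> (\<Union>i<n. C i) \<longleftrightarrow> y \<in> (\<Union>i<n. C i))"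
      using Q(2) C(3) by (fastforce simp: le_fun_def)
    have "measure M (((\<Union>i. a i) - (\<Union>i<n. C i)) \<union> ((\<Union>i<n. C i) - (\<Union>i. a i)))
      \<le> measure M (((\<Union>i. a i) - (\<Union>i<n. a i)) \<union> (\<Union>i<n. (a i - C i) \<union> (C i - a i)))"
      using aM C(1) by (intro finite_measure_mono) auto
    also have "\<dots> \<le> measure M ((\<Union>i. a i) - (\<Union>i<n. a i)) + measure M (\<Union>i<n. (a i - C i) \<union> (C i - a i))"
      using aM C(1) by (intro measure_Un_le) auto
    also have "measure M ((\<Union>i. a i) - (\<Union>i<n. a i)) = measure M (\<Union>i. a i) - measure M (\<Union>i<n. a i)"
      using aM by (intro finite_measure_Diff) auto
    also have "measure M (\<Union>i<n. (a i - C i) \<union> (C i - a i)) \<le> (\<Sum>i<n. measure M ((a i - C i) \<union> (C i - a i)))"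
      using aM C(1) by (intro finite_measure_subadditive_finite) auto
    also have "\<dots> \<le> (\<Sum>i<n. d i)" using C(4) by (intro sum_mono less_imp_le) auto
    also have "\<dots> \<le> e / 2"
    proof -
      have "(\<Sum>i<n. d i) = e/2 * (\<Sum>i<n. (1/2::real) ^ Suc i)" by (simp add: d_def sum_distrib_left)
      also have "(\<Sum>i<n. (1/2::real) ^ Suc i) \<le> 1"
      proof -
        have "(\<Sum>i<n. (1/2::real) ^ Suc i) = 1 - (1/2)^n" by (induction n) (auto simp: field_simps)
        then show ?thesis by simp
      qed
      finally show ?thesis using \<open>e > 0\<close> by (simp add: mult_left_le)
    qed
    finally have "measure M (((\<Union>i. a i) - (\<Union>i<n. C i)) \<union> ((\<Union>i<n. C i) - (\<Union>i. a i))) < e"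
      using n by simp
    then show ?case using Qd Q(1) C(1)
      by (intro bexI[of _ "\<Union>i<n. C i"] bexI[of _ Q]) auto
  qed
qed

text \<open>The level sets of \<open>T\<close> are approximated one at a time and a function is
  rebuilt from them. The sets \<open>D\<close> need to agree with the level sets only up to null
  sets, which is the form that \<open>generating\<close> supplies.\<close>

lemma directed_approx_fun:
  fixes \<R> :: "('a \<Rightarrow> 'a \<Rightarrow> bool) set" and T :: "'a \<Rightarrow> nat"
  assumes "finite_measure M" and sp: "space M = UNIV"
    and ne: "\<R> \<noteq> {}"
    and dir: "\<And>R S. R \<in> \<R> \<Longrightarrow> S \<in> \<R> \<Longrightarrow> \<exists>Q\<in>\<R>. Q \<le> R \<and> Q \<le> S"
    and gen: "\<G> \<subseteq> sets M"
    and det: "\<And>B. B \<in> \<G> \<Longrightarrow> \<exists>R\<in>\<R>. \<forall>x y. R x y \<longrightarrow> (x \<in> B \<longleftrightarrow> y \<in> B)"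
    and T[measurable]: "T \<in> measurable M (count_space UNIV)" and Tn: "\<And>x. T x \<le> n"
    and D: "\<And>j. \<exists>D\<in>sigma_sets UNIV \<G>. (T -` {j} - D) \<union> (D - T -` {j}) \<in> null_sets M"
    and e: "(e::real) > 0"
  shows "\<exists>T'. T' \<in> measurable M (count_space UNIV) \<and> (\<forall>x. T' x \<le> n) \<and>
           (\<exists>R\<in>\<R>. \<forall>x y. R x y \<longrightarrow> T' x = T' y) \<and> measure M {x. T x \<noteq> T' x} < e"
proof -
  interpret finite_measure M by fact
  have TM: "T -` {j} \<in> sets M" for j using measurable_sets[OF T, of "{j}"] sp by simp
  have inM: "X \<in> sets M" if "X \<in> sigma_sets UNIV \<G>" for X
    using that sets.sigma_sets_subset[OF gen] sp by auto
  \<comment> \<open>There are \<open>n + 1\<close> level sets, so the total error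
    \<open>(n + 1) * d\<close> is strictly below \<open>e\<close>.\<close>
  define d where "d = e / (2 + real n)"
  have d: "d > 0" using e by (simp add: d_def)
  have "\<exists>C R. C \<in> sets M \<and> R \<in> \<R> \<and> (\<forall>x y. R x y \<longrightarrow> (x \<in> C \<longleftrightarrow> y \<in> C)) \<and>
           measure M ((T -` {j} - C) \<union> (C - T -` {j})) < d" for j
  proof -
    obtain E where E: "E\<in>sigma_sets UNIV \<G>" "(T -` {j} - E) \<union> (E - T -` {j}) \<in> null_sets M"
      using D by blast
    from directed_approx_set[OF assms(1) sp ne dir gen det E(1) d]
    obtain C R where C: "C \<in> sets M" "R \<in> \<R>" "\<forall>x y. R x y \<longrightarrow> (x \<in> C \<longleftrightarrow> y \<in> C)"
      "measure M ((E - C) \<union> (C - E)) < d" by blast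
    have "measure M ((T -` {j} - C) \<union> (C - T -` {j}))
      \<le> measure M (((E - C) \<union> (C - E)) \<union> ((T -` {j} - E) \<union> (E - T -` {j})))"
      using TM C(1) inM[OF E(1)] by (intro finite_measure_mono) auto
    also have "\<dots> \<le> measure M ((E - C) \<union> (C - E)) + measure M ((T -` {j} - E) \<union> (E - T -` {j}))"
      using TM C(1) inM[OF E(1)] by (intro measure_Un_le) auto
    also have "measure M ((T -` {j} - E) \<union> (E - T -` {j})) = 0"
      using E(2) by (auto simp: measure_def null_sets_def)
    finally show ?thesis using C by (intro exI[of _ C] exI[of _ R]) auto
  qed
  then obtain C R where C: "\<And>i. C i \<in> sets M" "\<And>i. R i \<in> \<R>"
      "\<And>i x y. R i x y \<Longrightarrow> (x \<in> C i \<longleftrightarrow> y \<in> C i)"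
      "\<And>i. measure M ((T -` {i} - C i) \<union> (C i - T -` {i})) < d" by metis
  have [measurable]: "C i \<in> sets M" for i by fact
  have "\<exists>Q\<in>\<R>. \<forall>i<m. Q \<le> R i" for m :: nat
  proof (induction m)
    case 0 then show ?case using ne by auto
  next
    case (Suc m)
    then obtain Q where "Q\<in>\<R>" "\<forall>i<m. Q \<le> R i" by blast
    moreover from dir[OF this(1) C(2)[of m]] obtain S where "S\<in>\<R>" "S \<le> Q" "S \<le> R m" by blast
    ultimately show ?case by (intro bexI[of _ S]) (auto simp: less_Suc_eq intro: order_trans)
  qed
  from this[of "Suc n"] obtain Q where Q: "Q\<in>\<R>" "\<And>i. i \<le> n \<Longrightarrow> Q \<le> R i" by (auto simp: less_Suc_eq_le)
  \<comment> \<open>The sets \<open>C j\<close> may overlap or miss points; taking the least index,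
    with \<open>n\<close> as the default, still yields a total function bounded by
    \<open>n\<close>.\<close>
  define T' where "T' x = (LEAST j. j = n \<or> x \<in> C j)" for x
  have "T' \<in> measurable M (count_space UNIV)" unfolding T'_def
    by (rule measurable_Least) (auto simp: sp)
  moreover have "T' x \<le> n" for x unfolding T'_def by (rule Least_le) auto
  moreover have "T' x = T' y" if "Q x y" for x y
  proof -
    have CC: "x \<in> C j \<longleftrightarrow> y \<in> C j" if "j \<le> n" for j
      using C(3)[of j x y] Q(2)[OF that] \<open>Q x y\<close> by (auto simp: le_fun_def)
    \<comment> \<open>\<open>Q\<close> controls \<open>C j\<close> only for
      \<open>j \<le> n\<close>; the bounded form shows that the least index depends on no other
      sets.\<close>
    have "(LEAST j. j = n \<or> z \<in> C j) = (LEAST j. j \<le> n \<and> (j = n \<or> z \<in> C j))" for z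
    proof (rule antisym)
      have "(LEAST j. j = n \<or> z \<in> C j) \<le> n" by (rule Least_le) simp
      then show "(LEAST j. j \<le> n \<and> (j = n \<or> z \<in> C j)) \<le> (LEAST j. j = n \<or> z \<in> C j)"
        using LeastI[of "\<lambda>j. j = n \<or> z \<in> C j" n] by (intro Least_le) auto
      show "(LEAST j. j = n \<or> z \<in> C j) \<le> (LEAST j. j \<le> n \<and> (j = n \<or> z \<in> C j))"
        using LeastI[of "\<lambda>j. j \<le> n \<and> (j = n \<or> z \<in> C j)" n] by (intro Least_le) auto
    qed
    moreover have "(\<lambda>j. j \<le> n \<and> (j = n \<or> x \<in> C j)) = (\<lambda>j. j \<le> n \<and> (j = n \<or> y \<in> C j))"
      using CC by auto
    ultimately show ?thesis unfolding T'_def by simp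
  qed
  moreover have "measure M {x. T x \<noteq> T' x} < e"
  proof -
    \<comment> \<open>Outside the symmetric differences, \<open>x\<close> lies in \<open>C j\<close>
      exactly for \<open>j = T x\<close> among the indices up to \<open>n\<close>, so the least
      index is correct.\<close>
    have "{x. T x \<noteq> T' x} \<subseteq> (\<Union>i\<le>n. (T -` {i} - C i) \<union> (C i - T -` {i}))"
    proof (rule ccontr)
      assume "\<not> ?thesis"
      then obtain x where x: "T x \<noteq> T' x" "\<And>i. i \<le> n \<Longrightarrow> x \<in> C i \<longleftrightarrow> T x = i" by auto
      have "T' x = T x" unfolding T'_def
        proof (rule Least_equality)
        show "T x = n \<or> x \<in> C (T x)" using x(2)[OF Tn] by simp
        show "T x \<le> y" if "y = n \<or> x \<in> C y" for y
          using that x(2)[of y] Tn[of x] by (cases "y \<le> n") auto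
      qed
      then show False using x by simp
    qed
    then have "measure M {x. T x \<noteq> T' x} \<le> measure M (\<Union>i\<le>n. (T -` {i} - C i) \<union> (C i - T -` {i}))"
      using TM by (intro finite_measure_mono) auto
    also have "\<dots> \<le> (\<Sum>i\<le>n. measure M ((T -` {i} - C i) \<union> (C i - T -` {i})))"
      using TM by (intro finite_measure_subadditive_finite) auto
    also have "\<dots> \<le> (\<Sum>i\<le>n. d)" using C(4) by (intro sum_mono less_imp_le) auto
    also have "\<dots> < e" using e by (simp add: d_def field_simps)
    finally show ?thesis .
  qed
  ultimately show ?thesis using Q(1) by blast
qed

section \<open>Integrals of functions with finitely many values\<close>

lemma integral_finite_range:
  fixes f :: "nat \<Rightarrow> real"
  assumes "finite_measure M" and [measurable]: "T \<in> measurable M (count_space UNIV)"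
    and TN: "\<And>x. x \<in> space M \<Longrightarrow> T x < N"
  shows "integrable M (\<lambda>x. f (T x))"
    and "(\<integral>x. f (T x) \<partial>M) = (\<Sum>j<N. f j * measure M {x\<in>space M. T x = j})"
proof -
  interpret finite_measure M by fact
  have eq: "f (T x) = (\<Sum>j<N. f j * indicator {x\<in>space M. T x = j} x)" if "x \<in> space M" for x
    using TN[OF that] that by (simp add: indicator_def of_bool_def[symmetric] if_distrib cong: if_cong)
  have int: "integrable M (\<lambda>x. f j * indicator {x\<in>space M. T x = j} x)" for j
    by (intro integrable_mult_right integrable_real_indicator) (auto simp: emeasure_eq_measure)
  have "integrable M (\<lambda>x. \<Sum>j<N. f j * indicator {x\<in>space M. T x = j} x)"
    by (intro Bochner_Integration.integrable_sum int)
  then show "integrable M (\<lambda>x. f (T x))"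
    by (rule Bochner_Integration.integrable_cong[THEN iffD1, rotated -1]) (auto simp: eq)
  have "(\<integral>x. f (T x) \<partial>M) = (\<integral>x. (\<Sum>j<N. f j * indicator {x\<in>space M. T x = j} x) \<partial>M)"
    by (intro Bochner_Integration.integral_cong eq refl)
  also have "\<dots> = (\<Sum>j<N. f j * measure M {x\<in>space M. T x = j})"
    using int by (subst Bochner_Integration.integral_sum) (auto simp: Int_absorb2 intro!: sum.cong)
  finally show "(\<integral>x. f (T x) \<partial>M) = (\<Sum>j<N. f j * measure M {x\<in>space M. T x = j})" .
qed

section \<open>Finite labellings of large entropy\<close>

text \<open>The points outside all \<open>A i\<close> receive the extra label \<open>n\<close> with
  weight 1. As \<open>ln 1 = 0\<close>, this label contributes nothing and the integral equals the
  given sum.\<close>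

lemma (in prob_space) finite_labelling_of_disjoint_sets:
  fixes A :: "nat \<Rightarrow> 'a set" and r :: "nat \<Rightarrow> real"
  assumes A: "\<And>i. i < n \<Longrightarrow> A i \<in> sets M" and disj: "disjoint_family_on A {..<n}"
    and r: "\<And>i. i < n \<Longrightarrow> 0 < r i \<and> r i \<le> 1 \<and> measure M (A i) \<le> r i"
    and large: "(\<Sum>i<n. measure M (A i) * - ln (r i)) > B"
  shows "\<exists>N \<beta> r'. \<beta> \<in> measurable M (count_space UNIV) \<and> (\<forall>x. \<beta> x < N) \<and>
     (\<forall>j. 0 < r' j \<and> r' j \<le> (1::real) \<and> measure M {x\<in>space M. \<beta> x = (j::nat)} \<le> r' j) \<and>
     (\<integral>x. - ln (r' (\<beta> x)) \<partial>M) > B"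
proof -
  define \<beta> where "\<beta> x = (LEAST i. i = n \<or> (i < n \<and> x \<in> A i))" for x
  define r' where "r' i = (if i < n then r i else 1)" for i
  have "Measurable.pred M (\<lambda>x. i = n \<or> (i < n \<and> x \<in> A i))" for i
    using A[of i] by (cases "i < n"; cases "i = n") auto
  then have \<beta>m: "\<beta> \<in> measurable M (count_space UNIV)"
    unfolding \<beta>_def by (rule measurable_Least)
  have \<beta>n: "\<beta> x \<le> n" for x unfolding \<beta>_def by (rule Least_le) auto
  have \<beta>eq: "\<beta> x = i \<longleftrightarrow> x \<in> A i" if "i < n" for i x
  proof
    assume "\<beta> x = i"
    moreover have "\<beta> x = n \<or> (\<beta> x < n \<and> x \<in> A (\<beta> x))"
      unfolding \<beta>_def by (rule LeastI[of _ n]) simp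
    ultimately show "x \<in> A i" using that by auto
  next
    assume x: "x \<in> A i"
    show "\<beta> x = i" unfolding \<beta>_def
    proof (rule Least_equality)
      show "i = n \<or> i < n \<and> x \<in> A i" using that x by simp
      show "i \<le> y" if y: "y = n \<or> y < n \<and> x \<in> A y" for y
        using disjoint_family_onD[OF disj, of i y] x y \<open>i < n\<close> by (cases "y = i") auto
    qed
  qed
  have sA: "{x\<in>space M. \<beta> x = i} = A i" if "i < n" for i
    using \<beta>eq[OF that] A[OF that] sets.sets_into_space by blast
  have "(\<integral>x. - ln (r' (\<beta> x)) \<partial>M) = (\<Sum>j<Suc n. - ln (r' j) * measure M {x\<in>space M. \<beta> x = j})"
    using \<beta>n by (intro integral_finite_range) (auto simp: less_Suc_eq_le finite_measure_axioms \<beta>m)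
  also have "\<dots> = (\<Sum>i<n. measure M (A i) * - ln (r i))"
    by (simp add: r'_def sA mult.commute)
  finally have "(\<integral>x. - ln (r' (\<beta> x)) \<partial>M) > B" using large by simp
  moreover have "0 < r' j \<and> r' j \<le> 1 \<and> measure M {x\<in>space M. \<beta> x = j} \<le> r' j" for j
    using r[of j] sA[of j] by (auto simp: r'_def)
  ultimately show ?thesis using \<beta>m \<beta>n by (intro exI[of _ "Suc n"] exI[of _ \<beta>] exI[of _ r']) (auto simp: less_Suc_eq_le)
qed

lemma nn_integral_count_space_infinite_imp_large_sum:
  fixes f :: "'a \<Rightarrow> real"
  assumes "(\<integral>\<^sup>+ x. ennreal (f x) \<partial>count_space UNIV) = \<infinity>" and "\<And>x. f x \<ge> 0"
  shows "\<exists>F. finite F \<and> sum f F > B"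
proof (rule ccontr)
  assume "\<not> ?thesis"
  then have "Infinite_Set_Sum.abs_summable_on f UNIV"
    using assms(2) by (intro abs_summable_finite_sumsI[of _ _ B]) (auto simp: not_less)
  from nn_integral_conv_infsetsum[OF this] assms show False by simp
qed

text \<open>Around a point of measure zero, shrinking balls have measure tending to zero, so each
  point of \<open>U\<close> lies in a basic open set of measure at most \<open>e\<close>. A
  countable basis leaves countably many such sets, which are then made disjoint.\<close>

lemma diffuse_small_disjoint_cover:
  fixes M :: "'a::polish_space measure"
  assumes "finite_measure M" and sets[measurable_cong]: "sets M = sets borel" and e: "(e::real) > 0"
    and U[measurable]: "U \<in> sets borel" and diff: "\<And>x. x \<in> U \<Longrightarrow> measure M {x} = 0"
  shows "\<exists>A::nat \<Rightarrow> 'a set. (\<forall>i. A i \<in> sets M \<and> measure M (A i) \<le> e) \<and>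
           disjoint_family A \<and> (\<Union>i. A i) = U"
proof -
  interpret finite_measure M by fact
  obtain \<B> :: "'a set set" where \<B>: "countable \<B>" "\<And>X. X \<in> \<B> \<Longrightarrow> open X"
    "\<And>X x. open X \<Longrightarrow> x \<in> X \<Longrightarrow> \<exists>Y\<in>\<B>. x \<in> Y \<and> Y \<subseteq> X"
    using ex_countable_basis topological_basisE topological_basis_open by metis
  \<comment> \<open>The empty set keeps the family nonempty, as the enumeration by
    \<open>from_nat_into\<close> requires.\<close>
  define \<C> where "\<C> = insert {} {X\<in>\<B>. measure M X \<le> e}"
  have \<C>: "countable \<C>" "\<C> \<noteq> {}" using \<B>(1) by (auto simp: \<C>_def)
  define O' where "O' = from_nat_into \<C>"
  have O': "O' i \<in> \<C>" for i using \<C> by (simp add: O'_def from_nat_into)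
  have ro: "range O' = \<C>" using \<C> by (simp add: O'_def)
  have OM[measurable]: "O' i \<in> sets borel" "measure M (O' i) \<le> e" for i
    using O'[of i] \<B>(2) e by (auto simp: \<C>_def)
  have cover: "x \<in> (\<Union>i. O' i)" if "x \<in> U" for x
  proof -
    have "(\<lambda>n. measure M (ball x (1 / Suc n))) \<longlonglongrightarrow> measure M (\<Inter>n. ball x (1 / Suc n))"
    proof (rule finite_Lim_measure_decseq)
      show "range (\<lambda>n. ball x (1 / Suc n)) \<subseteq> sets M" by (auto simp: sets)
      show "decseq (\<lambda>n. ball x (1 / Suc n))"
        by (intro decseq_SucI subset_ball) (simp add: frac_le)
    qed
    also have "(\<Inter>n. ball x (1 / Suc n)) = {x}"
    proof -
      have "y = x" if y: "\<And>n. dist x y < 1 / Suc n" for y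
      proof (rule ccontr)
        assume "y \<noteq> x"
        then have "dist x y > 0" by simp
        then obtain n where "inverse (real (Suc n)) < dist x y" using reals_Archimedean by blast
        then show False using y[of n] by (simp add: inverse_eq_divide)
      qed
      then show ?thesis by auto
    qed
    finally have "(\<lambda>n. measure M (ball x (1 / Suc n))) \<longlonglongrightarrow> 0" using diff[OF that] by simp
    then have "\<forall>\<^sub>F n in sequentially. measure M (ball x (1 / Suc n)) < e" using e by (rule order_tendstoD)
    then obtain n where n: "measure M (ball x (1 / Suc n)) < e" by (auto simp: eventually_sequentially)
    obtain Y where Y: "Y\<in>\<B>" "x \<in> Y" "Y \<subseteq> ball x (1 / Suc n)"
      using \<B>(3)[of "ball x (1 / Suc n)" x] by auto
    have "measure M Y \<le> measure M (ball x (1 / Suc n))"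
      using Y(3) by (intro finite_measure_mono) (auto simp: sets)
    then have "Y \<in> \<C>" using n Y by (auto simp: \<C>_def)
    then show ?thesis using Y(2) ro by auto
  qed
  define A where "A i = U \<inter> disjointed O' i" for i
  have dj: "disjointed O' i \<in> sets borel" for i
    unfolding disjointed_def by measurable
  have "A i \<in> sets M" for i using dj[of i] U by (auto simp: A_def sets)
  moreover have "measure M (A i) \<le> e" for i
  proof -
    have "measure M (A i) \<le> measure M (O' i)"
      using disjointed_subset[of O' i] OM(1) by (intro finite_measure_mono) (auto simp: A_def sets)
    then show ?thesis using OM(2)[of i] by simp
  qed
  moreover have "disjoint_family A"
    using disjoint_family_disjointed[of O'] by (auto simp: disjoint_family_on_def A_def)
  moreover have "(\<Union>i. A i) = U"
    using cover UN_disjointed_eq[of O'] by (auto simp: A_def)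
  ultimately show ?thesis by (intro exI[of _ A]) auto
qed

text \<open>If \<kappa> is carried by a countable set, a finite part of the divergent entropy sum is
  already large. Otherwise positive mass lies off the atoms and can be cut into cells of arbitrarily
  small probability.\<close>

lemma infinite_measure_entropy_imp_large_labelling:
  fixes \<kappa> :: "'k::polish_space measure"
  assumes "prob_space \<kappa>" and sets[measurable_cong]: "sets \<kappa> = sets borel"
    and inf: "measure_entropy \<kappa> = \<infinity>"
  shows "\<exists>N \<beta> r. \<beta> \<in> measurable \<kappa> (count_space UNIV) \<and> (\<forall>x. \<beta> x < N) \<and>
     (\<forall>j. 0 < r j \<and> r j \<le> (1::real) \<and> measure \<kappa> {x\<in>space \<kappa>. \<beta> x = (j::nat)} \<le> r j) \<and>
     (\<integral>x. - ln (r (\<beta> x)) \<partial>\<kappa>) > B"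
proof -
  interpret prob_space \<kappa> by fact
  have sp: "space \<kappa> = UNIV" using sets_eq_imp_space_eq[OF sets] by simp
  have pt: "{x} \<in> sets \<kappa>" for x by (simp add: sets)
  define \<eta> where "\<eta> x = - measure \<kappa> {x} * ln (measure \<kappa> {x})" for x
  show ?thesis
  proof (cases "\<exists>C. countable C \<and> C \<in> sets \<kappa> \<and> emeasure \<kappa> C = 1")
    case True
    have "(\<integral>\<^sup>+ x. ennreal (\<eta> x) \<partial>count_space UNIV) = \<infinity>"
      using inf True by (simp add: measure_entropy_def \<eta>_def)
    moreover have \<eta>0: "\<eta> x \<ge> 0" for x
      using mult_nonneg_nonpos[of "measure \<kappa> {x}" "ln (measure \<kappa> {x})"]
      by (cases "measure \<kappa> {x} = 0") (auto simp: \<eta>_def zero_less_measure_iff)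
    ultimately obtain S where S: "finite S" "sum \<eta> S > B"
      using nn_integral_count_space_infinite_imp_large_sum by blast
    \<comment> \<open>Null points contribute nothing to the sum but would violate the positivity of
      the weights.\<close>
    define S' where "S' = {x\<in>S. measure \<kappa> {x} \<noteq> 0}"
    have S'f: "finite S'" using S by (simp add: S'_def)
    have "sum \<eta> S = sum \<eta> S'"
      using S(1) by (intro sum.mono_neutral_right) (auto simp: S'_def \<eta>_def)
    moreover obtain h where h: "bij_betw h {..<card S'} S'"
      using S'f bij_betw_from_nat_into_finite by blast
    ultimately have "(\<Sum>i<card S'. \<eta> (h i)) > B"
      using S(2) sum.reindex_bij_betw[OF h, of \<eta>] by simp
    moreover have "disjoint_family_on (\<lambda>i. {h i}) {..<card S'}"
      using bij_betw_imp_inj_on[OF h] by (auto simp: disjoint_family_on_def inj_on_def)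
    moreover have "measure \<kappa> {h i} > 0" if "i < card S'" for i
    proof -
      have "h i \<in> S'" using h that by (auto simp: bij_betw_def)
      then show ?thesis by (auto simp: S'_def zero_less_measure_iff)
    qed
    ultimately show ?thesis
      by (intro finite_labelling_of_disjoint_sets[of "card S'" "\<lambda>i. {h i}" "\<lambda>i. measure \<kappa> {h i}"])
         (auto simp: pt \<eta>_def)
  next
    case False
    \<comment> \<open>There are only countably many atoms, so by the case assumption they do not
      carry full measure and \<open>U\<close> has positive mass.\<close>
    define C where "C = {x. measure \<kappa> {x} \<noteq> 0}"
    have cC: "countable C" unfolding C_def by (rule countable_support)
    have CM: "C \<in> sets \<kappa>" using sets.countable[OF pt cC] .
    define U where "U = - C"
    have UM: "U \<in> sets \<kappa>" using CM sets.compl_sets[OF CM] by (simp add: U_def sp Compl_eq_Diff_UNIV)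
    have "measure \<kappa> C \<noteq> 1" using False cC CM by (auto simp: emeasure_eq_measure)
    then have "measure \<kappa> U > 0"
      using prob_compl[OF CM] prob_le_1[of C] by (auto simp: U_def sp Compl_eq_Diff_UNIV less_le)
    then obtain \<theta> where \<theta>: "\<theta> > 0" "measure \<kappa> U > \<theta>" using dense by blast
    \<comment> \<open>Mass above \<theta> in cells of weight \<open>e\<close> gives more than
      \<open>\<theta> * - ln e = \<bar>B\<bar> + 1\<close>. The absolute value ensures
      \<open>e \<le> 1\<close> whatever the sign of \<open>B\<close>.\<close>
    define e where "e = exp (- ((\<bar>B\<bar> + 1) / \<theta>))"
    have e: "e > 0" "e \<le> 1" "- ln e = (\<bar>B\<bar> + 1) / \<theta>"
      using \<theta>(1) by (simp_all add: e_def)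
    have "U \<in> sets borel" using UM sets by simp
    moreover have "measure \<kappa> {x} = 0" if "x \<in> U" for x using that by (simp add: U_def C_def)
    ultimately obtain A :: "nat \<Rightarrow> 'k set" where A: "\<And>i. A i \<in> sets \<kappa>" "\<And>i. measure \<kappa> (A i) \<le> e"
      "disjoint_family A" "(\<Union>i. A i) = U"
      using diffuse_small_disjoint_cover[OF finite_measure_axioms sets e(1)] by metis
    have "(\<lambda>i. measure \<kappa> (A i)) sums measure \<kappa> U"
      using finite_measure_UNION[of A] A by auto
    then have "(\<lambda>n. \<Sum>i<n. measure \<kappa> (A i)) \<longlonglongrightarrow> measure \<kappa> U" by (simp add: sums_def)
    from order_tendstoD(1)[OF this \<theta>(2)]
    obtain n where n: "(\<Sum>i<n. measure \<kappa> (A i)) > \<theta>" by (auto simp: eventually_sequentially)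
    have "B < \<theta> * ((\<bar>B\<bar> + 1) / \<theta>)" using \<theta> by simp
    also have "\<dots> \<le> (\<Sum>i<n. measure \<kappa> (A i)) * ((\<bar>B\<bar> + 1) / \<theta>)"
      using n \<theta> by (intro mult_right_mono) auto
    also have "\<dots> = (\<Sum>i<n. measure \<kappa> (A i) * - ln e)" unfolding e(3) by (rule sum_distrib_right)
    finally have large: "B < (\<Sum>i<n. measure \<kappa> (A i) * - ln e)" .
    have "disjoint_family_on A {..<n}" using A(3) by (rule disjoint_family_on_mono[rotated]) simp
    from finite_labelling_of_disjoint_sets[OF A(1) this _ large] show ?thesis using A(2) e(1,2) by blast
  qed
qed

section \<open>The coding inequality\<close>

text \<open>
  Any function of the labels \<open>a\<close> can be used to guess the independent variables \<open>\<beta> (x v)\<close>. Instead of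
  Shannon entropy and Fano's inequality, the proof compares the true law of these variables with the
  mixture \<open>Z\<close> of guesses, using only \<open>ln t \<le> t - 1\<close>. The weights \<open>r\<close> need only dominate the cell
  probabilities, which allows for cells of probability zero.
\<close>

lemma iid_coding_inequality:
  fixes \<kappa> :: "'k measure" and I :: "'i set" and a :: "'i \<Rightarrow> ('i \<Rightarrow> 'k) \<Rightarrow> nat"
    and p r :: "nat \<Rightarrow> real" and N n :: nat
  defines "P \<equiv> PiM I (\<lambda>_. \<kappa>)"
  assumes "prob_space \<kappa>" and I: "finite I" and VI: "V \<subseteq> I"
    and \<beta>[measurable]: "\<beta> \<in> measurable \<kappa> (count_space UNIV)" and \<beta>N: "\<And>k. \<beta> k < N"
    and r: "\<And>j. 0 < r j \<and> r j \<le> 1 \<and> measure \<kappa> {k\<in>space \<kappa>. \<beta> k = j} \<le> r j"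
    and a: "\<And>w. w \<in> I \<Longrightarrow> a w \<in> measurable P (count_space UNIV)"
    and an: "\<And>w x. a w x \<le> n"
    and p: "\<And>j. j \<le> n \<Longrightarrow> p j > 0" and psum: "(\<Sum>j\<le>n. p j) \<le> 1"
  shows "card V * (\<integral>k. - ln (r (\<beta> k)) \<partial>\<kappa>) \<le> (\<Sum>w\<in>I. \<integral>x. - ln (p (a w x)) \<partial>P) + card V * ln 2 +
     ln (2 * N) * (\<Sum>v\<in>V. measure P {x\<in>space P. \<beta> (x v) \<noteq> \<Psi> v (\<lambda>w\<in>I. a w x)})"
proof -
  interpret \<kappa>: prob_space \<kappa> by fact
  interpret product_prob_space "\<lambda>_. \<kappa>" I by unfold_locales
  interpret Q: prob_space P unfolding P_def by (intro prob_space_PiM \<kappa>.prob_space_axioms)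
  have V: "finite V" using VI I finite_subset by blast
  obtain k0 where "k0 \<in> space \<kappa>" using \<kappa>.not_empty by blast
  have N: "N > 0" using \<beta>N[of k0] by simp
  \<comment> \<open>\<open>S\<close> is the finite set of all possible codewords, one label per
    index.\<close>
  define S where "S = PiE I (\<lambda>_. {..n})"
  have S: "finite S" using I by (simp add: S_def finite_PiE)
  define c where "c v x = \<Psi> v (\<lambda>w\<in>I. a w x)" for v x
  \<comment> \<open>The guess distribution mixes the guess \<open>l\<close> and the uniform law on
    \<open>N\<close> labels, half each. A correct guess costs at most \<open>ln 2\<close> and a
    wrong one at most \<open>ln (2 * N)\<close>; these become the two error terms.\<close>
  define q where "q j l = (if j = l then 1/2 else 0) + 1 / (2 * real N)" for j l :: nat
  have q0: "q j l > 0" for j l using N by (auto simp: q_def add_pos_pos)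
  have qsum: "(\<Sum>j<N. q j l) \<le> 1" for l
    using N by (simp add: q_def sum.distrib)
  \<comment> \<open>The guess law relative to the weights \<open>r\<close>. Since \<open>r\<close>
    dominates the cell probabilities, each factor integrates to at most 1; indices outside
    \<open>V\<close> are neutral.\<close>
  define g where "g v s k = (if v \<in> V then q (\<beta> k) (\<Psi> v s) / r (\<beta> k) else 1)" for v s k
  have g0: "g v s k > 0" for v s k using q0 r by (simp add: g_def)
  have gi: "integrable \<kappa> (g v s)" and g1: "(\<integral>k. g v s k \<partial>\<kappa>) \<le> 1" for v s
  proof -
    have "integrable \<kappa> (\<lambda>k. q (\<beta> k) (\<Psi> v s) / r (\<beta> k))"
      using integral_finite_range(1)[OF \<kappa>.finite_measure_axioms \<beta> \<beta>N, of "\<lambda>j. q j (\<Psi> v s) / r j"] .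
    then show "integrable \<kappa> (g v s)" by (cases "v \<in> V") (simp_all add: g_def[abs_def])
    have "(\<integral>k. q (\<beta> k) (\<Psi> v s) / r (\<beta> k) \<partial>\<kappa>) =
        (\<Sum>j<N. q j (\<Psi> v s) / r j * measure \<kappa> {k\<in>space \<kappa>. \<beta> k = j})"
      using integral_finite_range(2)[OF \<kappa>.finite_measure_axioms \<beta> \<beta>N, of "\<lambda>j. q j (\<Psi> v s) / r j"] .
    also have "\<dots> \<le> (\<Sum>j<N. q j (\<Psi> v s))"
    proof (rule sum_mono)
      fix j
      have "q j (\<Psi> v s) / r j * measure \<kappa> {k\<in>space \<kappa>. \<beta> k = j} \<le> q j (\<Psi> v s) / r j * r j"
        using r[of j] q0[of j "\<Psi> v s"] by (intro mult_left_mono) auto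
      also have "\<dots> = q j (\<Psi> v s)" using r[of j] by simp
      finally show "q j (\<Psi> v s) / r j * measure \<kappa> {k\<in>space \<kappa>. \<beta> k = j} \<le> q j (\<Psi> v s)" .
    qed
    finally show "(\<integral>k. g v s k \<partial>\<kappa>) \<le> 1" using qsum[of "\<Psi> v s"]
      by (cases "v \<in> V") (simp_all add: g_def[abs_def] \<kappa>.prob_space)
  qed
  \<comment> \<open>\<open>t s\<close> is the prior weight of the codeword \<open>s\<close>, a
    product of weights \<open>p\<close>, times the likelihood ratio obtained when guessing from
    \<open>s\<close>. The mixture \<open>Z\<close> has integral at most 1 because integrals of
    products factor under the product measure.\<close>
  define t where "t s x = (\<Prod>w\<in>I. p (s w)) * (\<Prod>v\<in>I. g v s (x v))" for s x
  define Z where "Z x = (\<Sum>s\<in>S. t s x)" for x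
  have ti: "integrable P (t s)" for s
    unfolding t_def[abs_def] P_def by (intro integrable_mult_right product_integrable_prod I gi)
  have p0: "0 \<le> (\<Prod>w\<in>I. p (s w))" if "s \<in> S" for s
    using that p by (intro prod_nonneg ballI less_imp_le) (auto simp: S_def)
  have "(\<integral>x. Z x \<partial>P) = (\<Sum>s\<in>S. (\<Prod>w\<in>I. p (s w)) * (\<Prod>v\<in>I. \<integral>k. g v s k \<partial>\<kappa>))"
    unfolding Z_def using ti
    by (simp add: t_def[abs_def] P_def product_integral_prod[OF I gi])
  also have "\<dots> \<le> (\<Sum>s\<in>S. \<Prod>w\<in>I. p (s w))"
    using g1 by (intro sum_mono mult_left_le p0 prod_le_1 conjI Bochner_Integration.integral_nonneg less_imp_le[OF g0])
  also have "\<dots> = (\<Prod>w\<in>I. \<Sum>j\<le>n. p j)"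
    unfolding S_def using I by (subst prod_sum_PiE) auto
  also have "\<dots> \<le> 1" using psum p by (intro prod_le_1 conjI sum_nonneg) (auto intro: less_imp_le)
  finally have Z1: "(\<integral>x. Z x \<partial>P) \<le> 1" .
  have Zi: "integrable P Z" unfolding Z_def[abs_def] using ti by auto
  define E where "E v = {x\<in>space P. \<beta> (x v) \<noteq> c v x}" for v
  have Em: "E v \<in> sets P" if "v \<in> V" for v
  proof -
    have [measurable]: "(\<lambda>x. x v) \<in> measurable P \<kappa>"
      using that VI unfolding P_def by (intro measurable_component_singleton) auto
    \<comment> \<open>\<open>\<Psi>\<close> is arbitrary, so measurability is obtained by splitting
      along the finitely many codewords.\<close>
    have "E v = (\<Union>s\<in>S. {x\<in>space P. (\<forall>w\<in>I. a w x = s w) \<and> \<beta> (x v) \<noteq> \<Psi> v s})"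
    proof (intro set_eqI iffI)
      fix x assume "x \<in> E v"
      then show "x \<in> (\<Union>s\<in>S. {x\<in>space P. (\<forall>w\<in>I. a w x = s w) \<and> \<beta> (x v) \<noteq> \<Psi> v s})"
        using an by (intro UN_I[of "\<lambda>w\<in>I. a w x"]) (auto simp: E_def c_def S_def)
    next
      fix x assume "x \<in> (\<Union>s\<in>S. {x\<in>space P. (\<forall>w\<in>I. a w x = s w) \<and> \<beta> (x v) \<noteq> \<Psi> v s})"
      then obtain s where s: "s \<in> S" "x \<in> space P" "\<And>w. w \<in> I \<Longrightarrow> a w x = s w" "\<beta> (x v) \<noteq> \<Psi> v s" by auto
      have "(\<lambda>w\<in>I. a w x) = s" using s(1,3) by (intro ext) (auto simp: S_def PiE_def extensional_def)
      then show "x \<in> E v" using s by (simp add: E_def c_def)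
    qed
    also have "\<dots> \<in> sets P"
    proof (intro sets.finite_UN S sets.sets_Collect_conj sets.sets_Collect_finite_All I)
      fix s w assume "w \<in> I"
      note a[OF this, measurable]
      show "{x\<in>space P. a w x = s w} \<in> sets P" by measurable
    next
      fix s show "{x\<in>space P. \<beta> (x v) \<noteq> \<Psi> v s} \<in> sets P" by measurable
    qed
    finally show ?thesis .
  qed
  \<comment> \<open>\<open>L x\<close> is a lower bound for the logarithm of the one summand of
    \<open>Z x\<close> that belongs to the actual codeword of \<open>x\<close>. With
    \<open>ln t \<le> t - 1\<close> this gives \<open>L \<le> Z - 1\<close>, and integrating yields
    the claim.\<close>
  define L where "L x = (\<Sum>w\<in>I. ln (p (a w x))) - card V * ln 2 - ln (2 * N) * (\<Sum>v\<in>V. indicator (E v) x)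
      + (\<Sum>v\<in>V. - ln (r (\<beta> (x v))))" for x
  have LZ: "L x \<le> Z x - 1" if x: "x \<in> space P" for x
  proof -
    define s where "s = (\<lambda>w\<in>I. a w x)"
    have sS: "s \<in> S" using an by (auto simp: s_def S_def)
    have pp: "(\<Prod>w\<in>I. p (s w)) > 0" using p an by (intro prod_pos) (auto simp: s_def)
    have gp: "(\<Prod>v\<in>I. g v s (x v)) > 0" using g0 by (intro prod_pos) auto
    have t0: "t s x > 0" using pp gp by (simp add: t_def)
    have "ln (t s x) = (\<Sum>w\<in>I. ln (p (s w))) + (\<Sum>v\<in>I. ln (g v s (x v)))"
      unfolding t_def using pp gp g0 p an I
      by (subst ln_mult_pos) (auto simp: ln_prod s_def less_imp_neq[THEN not_sym])
    also have "(\<Sum>w\<in>I. ln (p (s w))) = (\<Sum>w\<in>I. ln (p (a w x)))" by (simp add: s_def)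
    also have "(\<Sum>v\<in>I. ln (g v s (x v))) = (\<Sum>v\<in>V. ln (g v s (x v)))"
      using I VI by (intro sum.mono_neutral_right) (auto simp: g_def)
    also have "\<dots> = (\<Sum>v\<in>V. ln (q (\<beta> (x v)) (c v x)) + - ln (r (\<beta> (x v))))"
      using q0 r by (intro sum.cong refl) (simp add: g_def ln_divide_pos c_def s_def)
    finally have lnt: "ln (t s x) = (\<Sum>w\<in>I. ln (p (a w x))) +
        (\<Sum>v\<in>V. ln (q (\<beta> (x v)) (c v x)) + - ln (r (\<beta> (x v))))" .
    have "(\<Sum>v\<in>V. (- ln 2 - ln (2 * N) * indicator (E v) x) + - ln (r (\<beta> (x v))))
      \<le> (\<Sum>v\<in>V. ln (q (\<beta> (x v)) (c v x)) + - ln (r (\<beta> (x v))))"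
    proof (intro sum_mono add_right_mono)
      fix v assume "v \<in> V"
      show "- ln 2 - ln (2 * N) * indicator (E v) x \<le> ln (q (\<beta> (x v)) (c v x))"
      proof (cases "\<beta> (x v) = c v x")
        case True
        then have "ln (1/2) \<le> ln (q (\<beta> (x v)) (c v x))"
          by (subst ln_le_cancel_iff) (auto simp: q0, simp add: q_def)
        then show ?thesis using True by (simp add: E_def ln_div)
      next
        case False
        have "ln (1 / (2 * real N)) \<le> ln (q (\<beta> (x v)) (c v x))"
          using N by (subst ln_le_cancel_iff) (auto simp: q0, simp add: q_def)
        then have A: "- ln (2 * N) \<le> ln (q (\<beta> (x v)) (c v x))" using N by (simp add: ln_div)
        have B: "indicator (E v) x = (1::real)" using False x by (simp add: E_def)
        have "ln (2::real) \<ge> 0" by simp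
        then show ?thesis unfolding B using A by linarith
      qed
    qed
    with lnt have "L x \<le> ln (t s x)"
      by (simp add: L_def sum.distrib sum_subtractf sum_distrib_left sum_negf)
    also have "\<dots> \<le> t s x - 1" using t0 by (rule ln_le_minus_one)
    also have "t s x \<le> Z x" unfolding Z_def using sS S g0 p0
      by (intro member_le_sum) (auto simp: t_def intro!: mult_nonneg_nonneg[OF p0] prod_nonneg intro: less_imp_le)
    finally show ?thesis by simp
  qed
  have ai: "integrable P (\<lambda>x. ln (p (a w x)))" if "w \<in> I" for w
    using integral_finite_range(1)[OF Q.finite_measure_axioms a[OF that], of "Suc n" "\<lambda>j. ln (p j)"] an
    by (simp add: less_Suc_eq_le)
  have ri: "integrable \<kappa> (\<lambda>k. - ln (r (\<beta> k)))"
    using integral_finite_range(1)[OF \<kappa>.finite_measure_axioms \<beta> \<beta>N, of "\<lambda>j. - ln (r j)"] .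
  have dis: "distr P \<kappa> (\<lambda>x. x v) = \<kappa>" and comp: "(\<lambda>x. x v) \<in> measurable P \<kappa>" if "v \<in> V" for v
    using that VI unfolding P_def by (auto intro!: PiM_component)
  have rP: "integrable P (\<lambda>x. - ln (r (\<beta> (x v))))" if "v \<in> V" for v
    using integrable_distr[OF comp[OF that], of "\<lambda>k. - ln (r (\<beta> k))"] ri dis[OF that] by simp
  have rE: "(\<integral>x. - ln (r (\<beta> (x v))) \<partial>P) = (\<integral>k. - ln (r (\<beta> k)) \<partial>\<kappa>)" if "v \<in> V" for v
    using integral_distr[OF comp[OF that], of "\<lambda>k. - ln (r (\<beta> k))"] ri dis[OF that] by simp
  have Ei: "integrable P (indicator (E v) :: _ \<Rightarrow> real)" if "v \<in> V" for v
    using Em[OF that] by (intro integrable_real_indicator) (auto simp: Q.emeasure_eq_measure)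
  have Li: "integrable P L" unfolding L_def[abs_def]
    by (intro Bochner_Integration.integrable_add Bochner_Integration.integrable_diff
        Bochner_Integration.integrable_sum integrable_mult_right ai rP Ei Q.integrable_const)
  have "(\<integral>x. L x \<partial>P) \<le> (\<integral>x. Z x - 1 \<partial>P)"
    using LZ Li Zi by (intro Bochner_Integration.integral_mono) auto
  also have "\<dots> \<le> 0" using Zi Z1 by (simp add: Q.prob_space)
  finally have L0: "(\<integral>x. L x \<partial>P) \<le> 0" .
  have "(\<integral>x. L x \<partial>P) = (\<Sum>w\<in>I. \<integral>x. ln (p (a w x)) \<partial>P) - card V * ln 2
      - ln (2 * N) * (\<Sum>v\<in>V. measure P (E v)) + (\<Sum>v\<in>V. \<integral>x. - ln (r (\<beta> (x v))) \<partial>P)"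
  proof -
    have i1: "integrable P (\<lambda>x. \<Sum>w\<in>I. ln (p (a w x)))" using ai by (rule Bochner_Integration.integrable_sum)
    have i2: "integrable P (\<lambda>x. ln (2 * N) * (\<Sum>v\<in>V. indicator (E v) x))"
      by (intro integrable_mult_right Bochner_Integration.integrable_sum Ei)
    have i3: "integrable P (\<lambda>x. \<Sum>v\<in>V. - ln (r (\<beta> (x v))))" using rP by (rule Bochner_Integration.integrable_sum)
    have e2: "(\<integral>x. (\<Sum>v\<in>V. indicator (E v) x) \<partial>P) = (\<Sum>v\<in>V. measure P (E v))"
      using Ei sets.sets_into_space[OF Em]
      by (subst Bochner_Integration.integral_sum) (auto intro!: sum.cong simp: Int_absorb2)
    have e1: "(\<integral>x. (\<Sum>w\<in>I. ln (p (a w x))) \<partial>P) = (\<Sum>w\<in>I. \<integral>x. ln (p (a w x)) \<partial>P)"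
      by (rule Bochner_Integration.integral_sum[OF ai])
    have e3: "(\<integral>x. (\<Sum>v\<in>V. - ln (r (\<beta> (x v)))) \<partial>P) = (\<Sum>v\<in>V. \<integral>x. - ln (r (\<beta> (x v))) \<partial>P)"
      by (rule Bochner_Integration.integral_sum[OF rP])
    show ?thesis unfolding L_def e1[symmetric] e3[symmetric]
      using i1 i2 i3 e2 by (simp add: Q.prob_space)
  qed
  with L0 have "(\<Sum>v\<in>V. \<integral>x. - ln (r (\<beta> (x v))) \<partial>P) \<le> (\<Sum>w\<in>I. \<integral>x. - ln (p (a w x)) \<partial>P)
     + card V * ln 2 + ln (2 * N) * (\<Sum>v\<in>V. measure P (E v))"
    by (simp add: sum_negf)
  then show ?thesis using rE by (simp add: E_def c_def)
qed

section \<open>Windows and shift invariance\<close>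

text \<open>An injective reindexing carries a product measure to a product measure. A function that
  reads only the coordinates in \<open>S\<close> therefore has the same integral over any index set
  into which \<open>S\<close> is injected, even if \<tau> has collisions outside
  \<open>S\<close>.\<close>

lemma bernoulli_window_pullback:
  fixes \<kappa> :: "'k measure" and \<tau> :: "'g \<Rightarrow> 'i" and f :: "('g \<Rightarrow> 'k) \<Rightarrow> real"
  assumes "prob_space \<kappa>" and sp: "space \<kappa> = UNIV"
    and \<tau>: "inj_on \<tau> S" "\<And>h. \<tau> h \<in> I"
    and f[measurable]: "f \<in> borel_measurable (PiM UNIV (\<lambda>_. \<kappa>))"
    and dep: "\<And>y z. (\<And>h. h \<in> S \<Longrightarrow> y h = z h) \<Longrightarrow> f y = f z"
  shows "(\<integral>x. f (\<lambda>h. x (\<tau> h)) \<partial>PiM I (\<lambda>_. \<kappa>)) = (\<integral>y. f y \<partial>PiM UNIV (\<lambda>_. \<kappa>))"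
proof -
  interpret prob_space \<kappa> by fact
  \<comment> \<open>Configurations on \<open>S\<close> are completed by a fixed value so that
    \<open>f\<close> can be applied to them.\<close>
  define ext where "ext z = (\<lambda>h. if h \<in> S then z h else undefined)" for z :: "'g \<Rightarrow> 'k"
  have ext[measurable]: "ext \<in> measurable (PiM S (\<lambda>_. \<kappa>)) (PiM UNIV (\<lambda>_. \<kappa>))"
    unfolding ext_def
  proof (rule measurable_PiM_single')
    show "(\<lambda>z. if h \<in> S then z h else undefined) \<in> measurable (PiM S (\<lambda>_. \<kappa>)) \<kappa>" for h
      using sp by (cases "h \<in> S") auto
  qed (auto simp: sp)
  have fext[measurable]: "(\<lambda>z. f (ext z)) \<in> borel_measurable (PiM S (\<lambda>_. \<kappa>))" by measurable
  \<comment> \<open>The index type of \<open>J\<close> is left free, so that one argument covers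
    both \<open>\<tau>\<close> into \<open>I\<close> and the identity of the full index set.\<close>
  have *: "(\<integral>x. f (\<lambda>h. x (t h)) \<partial>PiM J (\<lambda>_. \<kappa>)) = (\<integral>z. f (ext z) \<partial>PiM S (\<lambda>_. \<kappa>))"
    if t: "inj_on t S" "\<And>h. t h \<in> J" for t :: "'g \<Rightarrow> 'j" and J
  proof -
    have m: "(\<lambda>x. \<lambda>h\<in>S. x (t h)) \<in> measurable (PiM J (\<lambda>_. \<kappa>)) (PiM S (\<lambda>_. \<kappa>))"
      using t(2) by (intro measurable_restrict measurable_component_singleton)
    have "distr (PiM J (\<lambda>_. \<kappa>)) (PiM S (\<lambda>_. \<kappa>)) (\<lambda>x. \<lambda>h\<in>S. x (t h)) = PiM S (\<lambda>_. \<kappa>)"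
      using t prob_space_axioms by (intro distr_PiM_reindex) auto
    then have "(\<integral>z. f (ext z) \<partial>PiM S (\<lambda>_. \<kappa>)) = (\<integral>x. f (ext (\<lambda>h\<in>S. x (t h))) \<partial>PiM J (\<lambda>_. \<kappa>))"
      using integral_distr[OF m fext] by simp
    also have "\<dots> = (\<integral>x. f (\<lambda>h. x (t h)) \<partial>PiM J (\<lambda>_. \<kappa>))"
      by (intro Bochner_Integration.integral_cong refl dep) (simp add: ext_def)
    finally show ?thesis by simp
  qed
  from *[OF \<tau>] *[of "\<lambda>h. h" UNIV] show ?thesis by simp
qed

section \<open>Invariance of the Bernoulli measure under the shift\<close>

lemma shift_measurable:
  assumes "space \<kappa> = UNIV"
  shows "shift g \<in> measurable (PiM UNIV (\<lambda>_. \<kappa>)) (PiM UNIV (\<lambda>_. \<kappa>))"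
  unfolding shift_def
  by (rule measurable_PiM_single') (auto simp: assms)

text \<open>Left translation is injective on the group, so this is the window pullback with the
  whole group as window.\<close>

lemma integral_shift:
  fixes \<kappa> :: "'k measure" and f :: "('g::group_add \<Rightarrow> 'k) \<Rightarrow> real"
  assumes "prob_space \<kappa>" and "space \<kappa> = UNIV" and "f \<in> borel_measurable (PiM UNIV (\<lambda>_. \<kappa>))"
  shows "(\<integral>x. f (shift g x) \<partial>PiM UNIV (\<lambda>_. \<kappa>)) = (\<integral>x. f x \<partial>PiM UNIV (\<lambda>_. \<kappa>))"
proof -
  have dep: "f y = f z" if "\<And>h. h \<in> UNIV \<Longrightarrow> y h = z h" for y z
  proof -
    have "y = z" using that by (intro ext) simp
    then show ?thesis by simp
  qed
  show ?thesis
    unfolding shift_def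
  proof (rule bernoulli_window_pullback[OF assms(1,2) _ _ assms(3) dep])
    show "inj_on ((+) (- g)) UNIV" by (simp add: inj_on_def)
  qed simp_all
qed

lemma mem_shift_image: "x \<in> shift g ` A \<longleftrightarrow> shift (- g) x \<in> A"
proof
  assume "shift (- g) x \<in> A"
  then have "shift g (shift (- g) x) \<in> shift g ` A" by blast
  then show "x \<in> shift g ` A" by (simp add: shift_def add.assoc[symmetric])
qed (auto simp: shift_def add.assoc[symmetric])

section \<open>Local approximations of partitions\<close>

text \<open>Cylinders over one coordinate generate the product sigma-algebra. The relations are
  agreement on a finite window, directed under union of windows.\<close>

lemma window_approx:
  fixes \<kappa> :: "'k measure" and T :: "('g \<Rightarrow> 'k) \<Rightarrow> nat"
  defines "M \<equiv> PiM UNIV (\<lambda>_. \<kappa>)"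
  assumes \<kappa>: "prob_space \<kappa>" and sp: "space \<kappa> = UNIV"
    and T: "T \<in> measurable M (count_space UNIV)" "\<And>x. T x \<le> n" and e: "(e::real) > 0"
  shows "\<exists>T' W. T' \<in> measurable M (count_space UNIV) \<and> (\<forall>x. T' x \<le> n) \<and> finite W \<and>
     (\<forall>x y. (\<forall>h\<in>W. x h = y h) \<longrightarrow> T' x = T' y) \<and> measure M {x. T x \<noteq> T' x} < e"
proof -
  interpret M: prob_space M unfolding M_def by (intro prob_space_PiM \<kappa>)
  have spM: "space M = UNIV" by (simp add: M_def space_PiM sp)
  define \<G> :: "('g \<Rightarrow> 'k) set set" where "\<G> = {{f. f i \<in> A} | i A. A \<in> sets \<kappa>}"
  have setsM: "sets M = sigma_sets UNIV \<G>"
    by (simp add: M_def sets_PiM_single \<G>_def sp)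
  define \<R> :: "(('g \<Rightarrow> 'k) \<Rightarrow> ('g \<Rightarrow> 'k) \<Rightarrow> bool) set"
    where "\<R> = {\<lambda>x y. \<forall>h\<in>W. x h = y h | W. finite W}"
  have RI: "(\<lambda>x y. \<forall>h\<in>W. x h = y h) \<in> \<R>" if "finite W" for W using that by (auto simp: \<R>_def)
  have 1: "\<R> \<noteq> {}" using RI[of "{}"] by blast
  have 2: "\<exists>Q\<in>\<R>. Q \<le> R \<and> Q \<le> S" if "R \<in> \<R>" "S \<in> \<R>" for R S
  proof -
    from that obtain W1 W2 where "finite W1" "finite W2" "R = (\<lambda>x y. \<forall>h\<in>W1. x h = y h)"
      "S = (\<lambda>x y. \<forall>h\<in>W2. x h = y h)" by (auto simp: \<R>_def)
    then show ?thesis by (intro bexI[OF _ RI[of "W1 \<union> W2"]]) (auto simp: le_fun_def)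
  qed
  have 3: "\<exists>R\<in>\<R>. \<forall>x y. R x y \<longrightarrow> (x \<in> B \<longleftrightarrow> y \<in> B)" if "B \<in> \<G>" for B
  proof -
    from that obtain i A where "B = {f. f i \<in> A}" by (auto simp: \<G>_def)
    then show ?thesis by (intro bexI[OF _ RI[of "{i}"]]) auto
  qed
  have 4: "\<exists>D\<in>sigma_sets UNIV \<G>. (T -` {j} - D) \<union> (D - T -` {j}) \<in> null_sets M" for j
    using measurable_sets[OF T(1), of "{j}"] by (intro bexI[of _ "T -` {j}"]) (auto simp: spM setsM[symmetric])
  have "\<G> \<subseteq> sets M" by (auto simp: setsM)
  from directed_approx_fun[OF M.finite_measure_axioms spM 1 2 this 3 T 4 e]
  show ?thesis by (auto simp: \<R>_def)
qed

text \<open>The relations are agreement of finitely many translates of \<open>min n idx\<close>, a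
  finite coarsening of the partition. Each translated atom respects one of them, and the generating
  property says that these atoms produce all measurable sets up to null sets.\<close>

lemma generator_approx:
  fixes \<kappa> :: "'k measure" and T idx :: "('g::group_add \<Rightarrow> 'k) \<Rightarrow> nat"
  defines "M \<equiv> PiM UNIV (\<lambda>_. \<kappa>)"
  assumes \<kappa>: "prob_space \<kappa>" and sp: "space \<kappa> = UNIV"
    and gen: "generating M (shift :: 'g \<Rightarrow> _) \<alpha>"
    and idx: "idx \<in> measurable M (count_space UNIV)" "\<And>A. A \<in> \<alpha> \<Longrightarrow> \<exists>j. A = {x. idx x = j}"
    and T: "T \<in> measurable M (count_space UNIV)" "\<And>x. T x \<le> N" and e: "(e::real) > 0"
  shows "\<exists>T' F n. T' \<in> measurable M (count_space UNIV) \<and> finite F \<and>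
     (\<forall>x y. (\<forall>g\<in>F. min n (idx (shift (- g) x)) = min n (idx (shift (- g) y))) \<longrightarrow> T' x = T' y) \<and>
     measure M {x. T x \<noteq> T' x} < e"
proof -
  interpret M: prob_space M unfolding M_def by (intro prob_space_PiM \<kappa>)
  have spM: "space M = UNIV" by (simp add: M_def space_PiM sp)
  define \<G> where "\<G> = {(shift :: 'g \<Rightarrow> ('g \<Rightarrow> 'k) \<Rightarrow> _) g ` A | g A. A \<in> \<alpha>}"
  have shift_vimage: "shift g ` {x. idx x = j} = (\<lambda>x. idx (shift (- g) x)) -` {j}" for g j
    unfolding set_eq_iff mem_shift_image by simp
  have \<G>M: "\<G> \<subseteq> sets M"
  proof
    fix B assume "B \<in> \<G>"
    then obtain g j where B: "B = (\<lambda>x. idx (shift (- g) x)) -` {j}"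
      using idx(2) shift_vimage by (fastforce simp: \<G>_def)
    have "(\<lambda>x. idx (shift (- g) x)) \<in> measurable M (count_space UNIV)"
      using measurable_compose[OF _ idx(1)] shift_measurable[OF sp] unfolding M_def by blast
    from measurable_sets[OF this, of "{j}"] show "B \<in> sets M" by (simp add: B spM)
  qed
  define R0 where "R0 F n x y \<longleftrightarrow> (\<forall>g\<in>F. min n (idx (shift (- g) x)) = min n (idx (shift (- g) y)))"
    for F n x y
  define \<R> where "\<R> = {R0 F n | F n. finite F}"
  have RI: "R0 F n \<in> \<R>" if "finite F" for F n using that by (auto simp: \<R>_def)
  have 1: "\<R> \<noteq> {}" using RI[of "{}"] by blast
  have 2: "\<exists>Q\<in>\<R>. Q \<le> R \<and> Q \<le> S" if "R \<in> \<R>" "S \<in> \<R>" for R S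
  proof -
    from that obtain F1 F2 n1 n2 where F: "finite F1" "finite F2" "R = R0 F1 n1" "S = R0 F2 n2"
      by (auto simp: \<R>_def)
    \<comment> \<open>Truncation at the larger threshold determines truncation at either smaller
      one.\<close>
    have mm: "min k a = min k b" if "min (max n1 n2) a = min (max n1 n2) b" "k = n1 \<or> k = n2"
      for a b k :: nat using that by (auto simp: min_def max_def split: if_splits)
    have "R0 (F1 \<union> F2) (max n1 n2) \<le> R0 F1 n1" "R0 (F1 \<union> F2) (max n1 n2) \<le> R0 F2 n2"
      unfolding le_fun_def R0_def le_bool_def using mm by blast+
    then show ?thesis using F by (intro bexI[OF _ RI[of "F1 \<union> F2"]]) auto
  qed
  have 3: "\<exists>R\<in>\<R>. \<forall>x y. R x y \<longrightarrow> (x \<in> B \<longleftrightarrow> y \<in> B)" if "B \<in> \<G>" for B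
  proof -
    from that obtain g j where B: "B = (\<lambda>x. idx (shift (- g) x)) -` {j}"
      using idx(2) shift_vimage by (fastforce simp: \<G>_def)
    \<comment> \<open>The threshold must exceed \<open>j\<close>: truncating at \<open>j\<close>
      itself would merge the cell \<open>j\<close> with all later ones.\<close>
    show ?thesis by (intro bexI[OF _ RI[of "{g}" "Suc j"]]) (auto simp: B R0_def min_def split: if_splits)
  qed
  have 4: "\<exists>D\<in>sigma_sets UNIV \<G>. (T -` {j} - D) \<union> (D - T -` {j}) \<in> null_sets M" for j
  proof -
    have "T -` {j} \<in> sets M" using measurable_sets[OF T(1), of "{j}"] by (simp add: spM)
    with gen show ?thesis by (auto simp: generating_def invariant_generated_def \<G>_def spM)
  qed
  from directed_approx_fun[OF M.finite_measure_axioms spM 1 2 \<G>M 3 T 4 e]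
  obtain T' F n where "T' \<in> measurable M (count_space UNIV)" "finite F"
    "\<forall>x y. R0 F n x y \<longrightarrow> T' x = T' y" "measure M {x. T x \<noteq> T' x} < e"
    by (auto simp: \<R>_def)
  then show ?thesis unfolding R0_def by blast
qed

text \<open>Numbering the atoms recodes the partition as a label function. Finite partition entropy
  becomes a uniform real bound on the partial sums over labels.\<close>

lemma finite_entropy_partition_index:
  assumes "prob_space M" and sp: "space M = UNIV" and part: "is_partition M \<alpha>"
    and fin: "partition_entropy M \<alpha> < \<infinity>"
  shows "\<exists>idx H. idx \<in> measurable M (count_space UNIV) \<and> (\<forall>A\<in>\<alpha>. \<exists>j::nat. A = {x. idx x = j}) \<and>
    (\<forall>n. (\<Sum>j<n. - measure M {x. idx x = j} * ln (measure M {x. idx x = j})) \<le> (H::real))"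
proof -
  interpret prob_space M by fact
  have cnt: "countable \<alpha>" and \<alpha>M: "\<alpha> \<subseteq> sets M" and dj: "disjoint \<alpha>" and un: "\<Union>\<alpha> = UNIV"
    using part by (auto simp: is_partition_def sp)
  define atom where "atom x = (THE A. A \<in> \<alpha> \<and> x \<in> A)" for x
  have uniq: "A = B" if "A \<in> \<alpha>" "B \<in> \<alpha>" "x \<in> A" "x \<in> B" for A B x
    using dj that by (auto simp: disjoint_def)
  have atom: "atom x = A" if "A \<in> \<alpha>" "x \<in> A" for x A
    unfolding atom_def using that uniq by (intro the_equality) auto
  have atom_in: "atom x \<in> \<alpha>" "x \<in> atom x" for x
  proof -
    obtain A where A: "A \<in> \<alpha>" "x \<in> A" using un by blast
    then show "atom x \<in> \<alpha>" "x \<in> atom x" using atom[OF A] by simp_all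
  qed
  define idx where "idx x = to_nat_on \<alpha> (atom x)" for x
  have lev: "{x. idx x = to_nat_on \<alpha> A} = A" if "A \<in> \<alpha>" for A
  proof (intro set_eqI iffI)
    fix x assume "x \<in> {x. idx x = to_nat_on \<alpha> A}"
    then have "atom x = A" using inj_on_to_nat_on[OF cnt] atom_in(1) that by (auto simp: idx_def inj_on_def)
    then show "x \<in> A" using atom_in(2)[of x] by simp
  qed (use atom that in \<open>simp add: idx_def\<close>)
  \<comment> \<open>Numbers not assigned to an atom have an empty level set and contribute zero
    entropy.\<close>
  have emp: "{x. idx x = j} = {}" if "j \<notin> to_nat_on \<alpha> ` \<alpha>" for j
    using that atom_in(1) by (auto simp: idx_def)
  have levM: "{x. idx x = j} \<in> sets M" for j
  proof (cases "j \<in> to_nat_on \<alpha> ` \<alpha>")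
    case True then show ?thesis using lev \<alpha>M by auto
  next
    case False then show ?thesis using emp by simp
  qed
  have "idx -` {j} \<inter> space M \<in> sets M" for j
  proof -
    have "idx -` {j} \<inter> space M = {x. idx x = j}" by (auto simp: sp)
    then show ?thesis using levM by simp
  qed
  then have m: "idx \<in> measurable M (count_space UNIV)"
    by (subst measurable_count_space_eq2_countable) auto
  define \<eta> where "\<eta> A = - measure M A * ln (measure M A)" for A
  have \<eta>0: "\<eta> A \<ge> 0" for A
    using mult_nonneg_nonpos[of "measure M A" "ln (measure M A)"]
    by (cases "measure M A = 0") (auto simp: \<eta>_def zero_less_measure_iff)
  have "(\<Sum>j<n. \<eta> {x. idx x = j}) \<le> enn2real (partition_entropy M \<alpha>)" for n
  proof -
    define J where "J = {A\<in>\<alpha>. to_nat_on \<alpha> A < n}"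
    have inj: "inj_on (to_nat_on \<alpha>) J"
      using inj_on_to_nat_on[OF cnt] by (rule inj_on_subset) (auto simp: J_def)
    have J: "finite J"
      by (rule finite_imageD[OF _ inj], rule finite_subset[of _ "{..<n}"]) (auto simp: J_def)
    have "(\<Sum>j<n. \<eta> {x. idx x = j}) = (\<Sum>j\<in>to_nat_on \<alpha> ` J. \<eta> {x. idx x = j})"
    proof (rule sum.mono_neutral_right)
      show "\<forall>j\<in>{..<n} - to_nat_on \<alpha> ` J. \<eta> {x. idx x = j} = 0"
      proof
        fix j assume "j \<in> {..<n} - to_nat_on \<alpha> ` J"
        then have "j \<notin> to_nat_on \<alpha> ` \<alpha>" by (auto simp: J_def)
        then show "\<eta> {x. idx x = j} = 0" by (simp add: emp \<eta>_def)
      qed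
    qed (auto simp: J_def)
    also have "\<dots> = (\<Sum>A\<in>J. \<eta> A)"
      using inj lev by (subst sum.reindex) (auto simp: J_def intro!: sum.cong)
    finally have eq: "(\<Sum>j<n. \<eta> {x. idx x = j}) = (\<Sum>A\<in>J. \<eta> A)" .
    have "ennreal (\<Sum>A\<in>J. \<eta> A) = (\<Sum>A\<in>J. ennreal (\<eta> A))" using \<eta>0 by (simp add: sum_ennreal)
    also have "\<dots> = (\<integral>\<^sup>+A. ennreal (\<eta> A) \<partial>count_space J)" using J by (simp add: nn_integral_count_space_finite)
    also have "\<dots> = (\<integral>\<^sup>+A. ennreal (\<eta> A) * indicator J A \<partial>count_space UNIV)"
      by (rule nn_integral_count_space_indicator) simp
    also have "\<dots> \<le> (\<integral>\<^sup>+A. ennreal (\<eta> A) * indicator \<alpha> A \<partial>count_space UNIV)"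
      by (intro nn_integral_mono) (auto simp: J_def indicator_def)
    also have "\<dots> = (\<integral>\<^sup>+A. ennreal (\<eta> A) \<partial>count_space \<alpha>)"
      by (rule nn_integral_count_space_indicator[symmetric]) simp
    also have "\<dots> = partition_entropy M \<alpha>" by (simp add: partition_entropy_def \<eta>_def)
    finally have "enn2real (ennreal (\<Sum>A\<in>J. \<eta> A)) \<le> enn2real (partition_entropy M \<alpha>)"
      using fin by (intro enn2real_mono) auto
    then show ?thesis using eq \<eta>0 by (simp add: sum_nonneg)
  qed
  then show ?thesis using m lev
    by (intro exI[of _ idx] exI[of _ "enn2real (partition_entropy M \<alpha>)"]) (auto simp: \<eta>_def)
qed

text \<open>Weights \<open>p\<close> of total at most 1 act as code lengths \<open>- ln p\<close>.
  Keeping them within a constant factor of the cell probabilities bounds the mean length by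
  \<open>H\<close> plus a constant that does not depend on the truncation \<open>n\<close>.\<close>

lemma truncated_partition_weights:
  assumes "prob_space M" and sp: "space M = UNIV" and idx[measurable]: "idx \<in> measurable M (count_space UNIV)"
    and H: "(\<Sum>j<n. - measure M {x. idx x = j} * ln (measure M {x. idx x = j})) \<le> (H::real)"
  shows "\<exists>p :: nat \<Rightarrow> real. (\<forall>j. 0 < p j \<and> p j \<le> 1) \<and> (\<Sum>j\<le>n. p j) \<le> 1 \<and>
     (\<integral>x. - ln (p (min n (idx x))) \<partial>M) \<le> H + ln 4"
proof -
  interpret prob_space M by fact
  define \<mu> where "\<mu> j = measure M {x. idx x = j}" for j
  \<comment> \<open>The share \<open>1 / real n\<close> gives null cells positive weight, the factor
    1/4 makes room for it at a cost of \<open>ln 4\<close>, and the label \<open>n\<close>, which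
    collects the whole tail, gets 1/2. The total is at most
    \<open>(1 + 1) / 4 + 1/2 = 1\<close>.\<close>
  define p where "p j = (if j < n then (\<mu> j + 1 / real n) / 4 else 1/2)" for j
  define \<nu> where "\<nu> j = measure M {x\<in>space M. min n (idx x) = j}" for j
  have min_m: "(\<lambda>x. min n (idx x)) \<in> measurable M (count_space UNIV)" by measurable
  have \<nu>\<mu>: "\<nu> j = \<mu> j" if "j < n" for j
  proof -
    have "{x\<in>space M. min n (idx x) = j} = {x. idx x = j}" using that by (auto simp: sp min_def)
    then show ?thesis by (simp add: \<nu>_def \<mu>_def)
  qed
  have int: "(\<integral>x. f (min n (idx x)) \<partial>M) = (\<Sum>j<Suc n. f j * \<nu> j)" for f :: "nat \<Rightarrow> real"
    unfolding \<nu>_def by (rule integral_finite_range(2)[OF finite_measure_axioms min_m]) simp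
  from int[of "\<lambda>_. 1"] have tot: "(\<Sum>j<n. \<mu> j) + \<nu> n = 1"
    by (simp add: prob_space \<nu>\<mu>)
  have \<mu>0: "\<mu> j \<ge> 0" "\<mu> j \<le> 1" and \<nu>0: "\<nu> j \<ge> 0" for j by (simp_all add: \<mu>_def \<nu>_def)
  have pp: "0 < p j \<and> p j \<le> 1" for j
  proof (cases "j < n")
    case True
    then have "0 < 1 / real n" "1 / real n \<le> 1" by auto
    then have "0 < \<mu> j + 1 / real n" "\<mu> j + 1 / real n \<le> 2" using \<mu>0[of j] by linarith+
    then show ?thesis using True by (simp add: p_def)
  qed (simp add: p_def)
  have "(\<Sum>j\<le>n. p j) = (\<Sum>j<n. (\<mu> j + 1 / real n) / 4) + 1/2"
    by (simp add: lessThan_Suc_atMost[symmetric] p_def)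
  also have "(\<Sum>j<n. (\<mu> j + 1 / real n) / 4) = ((\<Sum>j<n. \<mu> j) + (\<Sum>j<n. 1 / real n)) / 4"
    by (simp add: sum_divide_distrib[symmetric] sum.distrib)
  also have "\<dots> \<le> (1 + 1) / 4"
    using tot \<nu>0[of n] by (intro divide_right_mono add_mono) auto
  finally have ps: "(\<Sum>j\<le>n. p j) \<le> 1" by simp
  have cell: "- ln (p j) * \<nu> j \<le> - \<mu> j * ln (\<mu> j) + ln 4 * \<mu> j" if "j < n" for j
  proof (cases "\<mu> j = 0")
    case False
    then have "\<mu> j > 0" using \<mu>0(1)[of j] by linarith
    then have "ln (\<mu> j / 4) \<le> ln (p j)" using that pp[of j]
      by (subst ln_le_cancel_iff) (auto simp: p_def)
    then have "- ln (p j) \<le> ln 4 - ln (\<mu> j)" using \<open>\<mu> j > 0\<close> by (simp add: ln_divide_pos)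
    from mult_right_mono[OF this \<mu>0(1)[of j]] show ?thesis using that by (simp add: \<nu>\<mu> algebra_simps)
  qed (use that in \<open>simp add: \<nu>\<mu>\<close>)
  have l24: "ln (2::real) \<le> ln 4" by simp
  have "(\<integral>x. - ln (p (min n (idx x))) \<partial>M) = (\<Sum>j<n. - ln (p j) * \<nu> j) + ln 2 * \<nu> n"
    using ln_div[of 1 2] by (subst int[of "\<lambda>j. - ln (p j)"]) (simp add: p_def[of n])
  also have "\<dots> \<le> (\<Sum>j<n. - \<mu> j * ln (\<mu> j) + ln 4 * \<mu> j) + ln 4 * \<nu> n"
    using cell l24 \<nu>0 by (intro add_mono sum_mono mult_right_mono) auto
  also have "\<dots> = (\<Sum>j<n. - \<mu> j * ln (\<mu> j)) + ln 4 * ((\<Sum>j<n. \<mu> j) + \<nu> n)"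
    by (simp only: sum.distrib sum_distrib_left distrib_left add.assoc)
  also have "\<dots> \<le> H + ln 4" using H tot by (simp add: \<mu>_def)
  finally show ?thesis using pp ps by blast
qed

section \<open>Transfer to the sofic approximation\<close>

text \<open>A finite power of the discrete naturals is again discrete, so every function \<Phi> of
  the tuple is measurable.\<close>

lemma measurable_finite_tuple_compose:
  fixes f :: "'i \<Rightarrow> 'a \<Rightarrow> nat"
  assumes "finite F" and "\<And>g. g \<in> F \<Longrightarrow> f g \<in> measurable M (count_space UNIV)"
  shows "(\<lambda>x. \<Phi> (\<lambda>g\<in>F. f g x)) \<in> measurable M (count_space UNIV)"
proof -
  have "(\<lambda>x. \<lambda>g\<in>F. f g x) \<in> measurable M (PiM F (\<lambda>_. count_space UNIV))"
    by (intro measurable_restrict assms)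
  also have "PiM F (\<lambda>_. count_space (UNIV :: nat set)) = count_space (PiE F (\<lambda>_. UNIV))"
    using assms(1) by (intro count_space_PiM_finite) auto
  finally show ?thesis by (rule measurable_compose) simp
qed

text \<open>The order of choices matters. The decoder \<open>D\<close> comes with the truncation
  \<open>n\<close> and the translates \<open>F\<close>, and \<open>n\<close> determines the weights
  \<open>p\<close>; only then is the truncated label replaced by a rule \<open>a\<close> on a finite
  window, with an error small relative to all of these.\<close>

lemma finite_entropy_generator_local_code:
  fixes \<kappa> :: "'k measure" and \<beta> :: "'k \<Rightarrow> nat" and N :: nat
    and idx :: "('g::group_add \<Rightarrow> 'k) \<Rightarrow> nat"
  defines "M \<equiv> PiM UNIV (\<lambda>_. \<kappa>)"
  assumes \<kappa>: "prob_space \<kappa>" and sp: "space \<kappa> = UNIV"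
    and gen: "generating M (shift :: 'g \<Rightarrow> _) \<alpha>"
    and idx: "idx \<in> measurable M (count_space UNIV)" "\<forall>A\<in>\<alpha>. \<exists>j. A = {x. idx x = j}"
    and H: "\<And>n. (\<Sum>j<n. - measure M {x. idx x = j} * ln (measure M {x. idx x = j})) \<le> H"
    and \<beta>[measurable]: "\<beta> \<in> measurable \<kappa> (count_space UNIV)" and \<beta>N: "\<And>k. \<beta> k < N"
  shows "\<exists>n (p :: nat \<Rightarrow> real) a W F (\<Phi> :: ('g \<Rightarrow> nat) \<Rightarrow> nat).
     finite W \<and> finite F \<and> a \<in> measurable M (count_space UNIV) \<and> (\<forall>x. a x \<le> n) \<and>
     (\<forall>x y. (\<forall>h\<in>W. x h = y h) \<longrightarrow> a x = a y) \<and>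
     (\<forall>j. 0 < p j \<and> p j \<le> 1) \<and> (\<Sum>j\<le>n. p j) \<le> 1 \<and>
     (\<integral>x. - ln (p (a x)) \<partial>M) \<le> H + ln 4 + 1 \<and>
     {x. \<beta> (x 0) \<noteq> \<Phi> (\<lambda>g\<in>F. a (shift (- g) x))} \<in> sets M \<and>
     ln (2 * N) * measure M {x. \<beta> (x 0) \<noteq> \<Phi> (\<lambda>g\<in>F. a (shift (- g) x))} \<le> 2"
proof -
  interpret M: prob_space M unfolding M_def by (intro prob_space_PiM \<kappa>)
  have spM: "space M = UNIV" by (simp add: M_def space_PiM sp)
  have N: "N > 0" using \<beta>N[of undefined] by simp
  define l where "l = ln (2 * real N)"
  have l: "l > 0" using N by (simp add: l_def)
  have x0[measurable]: "(\<lambda>x. x (0::'g)) \<in> measurable M \<kappa>" unfolding M_def by simp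
  have \<beta>0[measurable]: "(\<lambda>x. \<beta> (x (0::'g))) \<in> measurable M (count_space UNIV)" by measurable
  have shM: "shift g \<in> measurable M M" for g :: 'g unfolding M_def by (rule shift_measurable[OF sp])
  \<comment> \<open>The error \<open>1 / l\<close> is chosen so that it costs at most 1 once
    multiplied by \<open>l = ln (2 * N)\<close>.\<close>
  obtain D F n where D[measurable]: "D \<in> measurable M (count_space UNIV)" and F: "finite F"
    and DF: "\<And>x y. (\<forall>g\<in>F. min n (idx (shift (- g) x)) = min n (idx (shift (- g) y))) \<Longrightarrow> D x = D y"
    and De: "measure M {x. \<beta> (x 0) \<noteq> D x} < 1 / l"
    using generator_approx[OF \<kappa> sp gen[unfolded M_def] idx(1)[unfolded M_def] idx(2)[rule_format],
        of "\<lambda>x. \<beta> (x 0)" N "1 / l"] \<beta>0 \<beta>N l by (auto simp: M_def less_imp_le)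
  obtain p :: "nat \<Rightarrow> real" where p: "\<And>j. 0 < p j \<and> p j \<le> 1" "(\<Sum>j\<le>n. p j) \<le> 1"
    "(\<integral>x. - ln (p (min n (idx x))) \<partial>M) \<le> H + ln 4"
    using truncated_partition_weights[OF M.prob_space_axioms spM idx(1) H[of n]] by blast
  define a0 where "a0 x = min n (idx x)" for x
  have a0[measurable]: "a0 \<in> measurable M (count_space UNIV)"
    unfolding a0_def using idx(1) by measurable
  have a0n: "a0 x \<le> n" for x by (simp add: a0_def)
  \<comment> \<open>No single code length exceeds \<open>L\<close>, so changing the label on a set
    of measure below \<open>d\<close> adds at most \<open>L * d\<close> to the mean.\<close>
  define L where "L = (\<Sum>j\<le>n. - ln (p j))"
  have lnp: "- ln (p j) \<ge> 0" for j using p(1)[of j] by simp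
  have L: "- ln (p j) \<le> L" if "j \<le> n" for j
    unfolding L_def using that lnp by (intro member_le_sum) auto
  have L0: "L \<ge> 0" unfolding L_def using lnp by (intro sum_nonneg) auto
  \<comment> \<open>This \<open>d\<close> keeps two losses at most 1: \<open>L * d\<close> in code
    length, and \<open>card F * l * d\<close> from wrong labels entering the decoder.\<close>
  define d where "d = 1 / (1 + L + card F * l)"
  have den: "1 + L + card F * l > 0" using L0 l by (simp add: add_pos_nonneg)
  have d: "d > 0" "L * d \<le> 1" "card F * l * d \<le> 1"
    using den L0 l by (auto simp: d_def divide_le_eq)
  obtain a W where a[measurable]: "a \<in> measurable M (count_space UNIV)" and an: "\<And>x. a x \<le> n"
    and W: "finite W" "\<And>x y. (\<forall>h\<in>W. x h = y h) \<Longrightarrow> a x = a y"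
    and ae: "measure M {x. a0 x \<noteq> a x} < d"
    using window_approx[OF \<kappa> sp, of a0 n d] a0 a0n d(1) by (auto simp: M_def)
  define B where "B = {x. a0 x \<noteq> a x}"
  have BM: "B \<in> sets M"
  proof -
    have "{x\<in>space M. a0 x \<noteq> a x} \<in> sets M" by measurable
    then show ?thesis by (simp add: B_def spM)
  qed
  \<comment> \<open>Any configuration showing the labels \<open>s\<close> on \<open>F\<close> may be
    decoded by \<open>D\<close>, since \<open>D\<close> depends on these labels only. Tuples that no
    configuration produces get an arbitrary value.\<close>
  define \<Phi> where "\<Phi> s = D (SOME x. \<forall>g\<in>F. a0 (shift (- g) x) = s g)" for s
  have \<Phi>: "\<Phi> s = D x" if "\<And>g. g \<in> F \<Longrightarrow> s g = a0 (shift (- g) x)" for s x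
  proof -
    have "\<forall>g\<in>F. a0 (shift (- g) (SOME x. \<forall>g\<in>F. a0 (shift (- g) x) = s g)) = s g"
      by (rule someI[of "\<lambda>x. \<forall>g\<in>F. a0 (shift (- g) x) = s g" x]) (simp add: that)
    then show ?thesis unfolding \<Phi>_def using that by (intro DF) (auto simp: a0_def)
  qed
  have "(\<integral>x. - ln (p (a x)) \<partial>M) \<le> (\<integral>x. - ln (p (a0 x)) + L * indicator B x \<partial>M)"
  proof (rule Bochner_Integration.integral_mono)
    show "integrable M (\<lambda>x. - ln (p (a x)))"
      using integral_finite_range(1)[OF M.finite_measure_axioms a, of "Suc n" "\<lambda>j. - ln (p j)"] an
      by (simp add: less_Suc_eq_le)
    have "integrable M (\<lambda>x. - ln (p (a0 x)))"
      using integral_finite_range(1)[OF M.finite_measure_axioms a0, of "Suc n" "\<lambda>j. - ln (p j)"] a0n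
      by (simp add: less_Suc_eq_le)
    then show "integrable M (\<lambda>x. - ln (p (a0 x)) + L * indicator B x)"
      using BM by (intro Bochner_Integration.integrable_add integrable_mult_right integrable_real_indicator)
        (auto simp: M.emeasure_eq_measure)
    show "- ln (p (a x)) \<le> - ln (p (a0 x)) + L * indicator B x" for x
    proof (cases "x \<in> B")
      case True then show ?thesis using L[OF an[of x]] lnp[of "a0 x"] by simp
    next
      case False then show ?thesis by (simp add: B_def)
    qed
  qed
  also have "\<dots> = (\<integral>x. - ln (p (a0 x)) \<partial>M) + L * measure M B"
    using BM integral_finite_range(1)[OF M.finite_measure_axioms a0, of "Suc n" "\<lambda>j. - ln (p j)"] a0n
    by (subst Bochner_Integration.integral_add) (auto simp: less_Suc_eq_le M.emeasure_eq_measure spM)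
  also have "\<dots> \<le> (H + ln 4) + L * d"
    using p(3) ae L0 by (intro add_mono mult_left_mono) (auto simp: a0_def B_def)
  finally have ent: "(\<integral>x. - ln (p (a x)) \<partial>M) \<le> H + ln 4 + 1" using d(2) by simp
  have BgM: "shift (- g) -` B \<in> sets M" for g :: 'g
    using measurable_sets[OF shM BM, of "- g"] by (simp add: spM)
  \<comment> \<open>By shift invariance every translate of the exceptional set has the same
    measure.\<close>
  have Bg: "measure M (shift (- g) -` B) \<le> d" for g :: 'g
  proof -
    have "measure M (shift (- g) -` B) = (\<integral>x. indicator (shift (- g) -` B) x \<partial>M)"
      by (simp add: spM)
    also have "\<dots> = (\<integral>x. indicator B (shift (- g) x) \<partial>M)"
      by (simp add: indicator_def)
    also have "\<dots> = (\<integral>x. indicator B x \<partial>M)"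
      using BM unfolding M_def by (intro integral_shift[OF \<kappa> sp]) auto
    also have "\<dots> = measure M B" by (simp add: spM)
    finally show ?thesis using ae by (simp add: B_def)
  qed
  have DM: "{x. \<beta> (x 0) \<noteq> D x} \<in> sets M"
  proof -
    have "{x\<in>space M. \<beta> (x 0) \<noteq> D x} \<in> sets M" by measurable
    then show ?thesis by (simp add: spM)
  qed
  define E where "E = {x. \<beta> (x 0) \<noteq> \<Phi> (\<lambda>g\<in>F. a (shift (- g) x))}"
  have EM: "E \<in> sets M"
  proof -
    have [measurable]: "(\<lambda>x. \<Phi> (\<lambda>g\<in>F. a (shift (- g) x))) \<in> measurable M (count_space UNIV)"
      by (rule measurable_finite_tuple_compose[OF F measurable_compose[OF shM a]])
    have "{x\<in>space M. \<beta> (x 0) \<noteq> \<Phi> (\<lambda>g\<in>F. a (shift (- g) x))} \<in> sets M" by measurable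
    then show ?thesis by (simp add: E_def spM)
  qed
  \<comment> \<open>A decoding error comes either from \<open>D\<close> or from a translate in
    \<open>F\<close> at which \<open>a\<close> and \<open>a0\<close> differ.\<close>
  have "E \<subseteq> {x. \<beta> (x 0) \<noteq> D x} \<union> (\<Union>g\<in>F. shift (- g) -` B)"
  proof
    fix x assume x: "x \<in> E"
    show "x \<in> {x. \<beta> (x 0) \<noteq> D x} \<union> (\<Union>g\<in>F. shift (- g) -` B)"
    proof (rule ccontr)
      assume n: "\<not> ?thesis"
      then have "\<Phi> (\<lambda>g\<in>F. a (shift (- g) x)) = D x" by (intro \<Phi>) (auto simp: B_def)
      then show False using n x by (auto simp: E_def)
    qed
  qed
  then have "measure M E \<le> measure M ({x. \<beta> (x 0) \<noteq> D x} \<union> (\<Union>g\<in>F. shift (- g) -` B))"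
    using DM BgM F by (intro M.finite_measure_mono) auto
  also have "\<dots> \<le> measure M {x. \<beta> (x 0) \<noteq> D x} + measure M (\<Union>g\<in>F. shift (- g) -` B)"
    using DM BgM F by (intro measure_Un_le) auto
  also have "\<dots> \<le> 1 / l + (\<Sum>g\<in>F. measure M (shift (- g) -` B))"
    using De BgM F by (intro add_mono measure_UNION_le) auto
  also have "\<dots> \<le> 1 / l + (\<Sum>g\<in>F. d)" using Bg by (intro add_left_mono sum_mono)
  finally have "measure M E \<le> 1 / l + card F * d" by simp
  from mult_left_mono[OF this, of l] l have "l * measure M E \<le> 1 + card F * l * d"
    by (simp add: algebra_simps)
  then have "l * measure M E \<le> 2" using d(3) by simp
  then show ?thesis using W F a an p(1,2) ent EM
    by (intro exI[of _ n] exI[of _ p] exI[of _ a] exI[of _ W] exI[of _ F] exI[of _ \<Phi>])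
       (auto simp: E_def l_def)
qed

text \<open>The rule \<open>a\<close> is evaluated at every vertex of a sofic model carrying
  independent labels of law \<kappa>. Good vertices see the Bernoulli statistics exactly, so the
  coding inequality, with the good vertices as \<open>V\<close>, gives the bound after division by
  their number. The summand \<open>ln 2\<close> comes from the guessing scheme; the summand 1
  absorbs the bad vertices.\<close>

lemma sofic_local_code_bound:
  fixes \<kappa> :: "'k measure" and \<beta> :: "'k \<Rightarrow> nat" and N n :: nat and p r :: "nat \<Rightarrow> real"
    and a :: "('g::group_add \<Rightarrow> 'k) \<Rightarrow> nat"
  defines "M \<equiv> PiM UNIV (\<lambda>_. \<kappa>)"
  assumes sofic: "sofic TYPE('g)" and \<kappa>: "prob_space \<kappa>" and sp: "space \<kappa> = UNIV"
    and \<beta>: "\<beta> \<in> measurable \<kappa> (count_space UNIV)" and \<beta>N: "\<And>k. \<beta> k < N"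
    and r: "\<And>j. 0 < r j \<and> r j \<le> 1 \<and> measure \<kappa> {k\<in>space \<kappa>. \<beta> k = j} \<le> r j"
    and W: "finite W" and F: "finite F"
    and a: "a \<in> measurable M (count_space UNIV)" and an: "\<And>x. a x \<le> n"
    and aW: "\<And>x y. (\<forall>h\<in>W. x h = y h) \<Longrightarrow> a x = a y"
    and p: "\<And>j. 0 < p j \<and> p j \<le> 1" and psum: "(\<Sum>j\<le>n. p j) \<le> 1"
    and ent: "(\<integral>x. - ln (p (a x)) \<partial>M) \<le> h"
    and EM: "{x. \<beta> (x 0) \<noteq> \<Phi> (\<lambda>g\<in>F. a (shift (- g) x))} \<in> sets M"
    and err: "ln (2 * N) * measure M {x. \<beta> (x 0) \<noteq> \<Phi> (\<lambda>g\<in>F. a (shift (- g) x))} \<le> c"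
  shows "(\<integral>k. - ln (r (\<beta> k)) \<partial>\<kappa>) \<le> h + c + ln 2 + 1"
proof -
  have spM: "space M = UNIV" by (simp add: M_def space_PiM sp)
  have N: "N > 0" using \<beta>N[of undefined] by simp
  define L where "L = (\<Sum>j\<le>n. - ln (p j))"
  have lnp: "- ln (p j) \<ge> 0" for j using p[of j] by simp
  have L: "- ln (p j) \<le> L" if "j \<le> n" for j
    unfolding L_def using that lnp by (intro member_le_sum) auto
  have L0: "L \<ge> 0" unfolding L_def using lnp by (intro sum_nonneg) auto
  obtain m :: "nat \<Rightarrow> nat" and \<sigma> :: "nat \<Rightarrow> 'g \<Rightarrow> nat \<Rightarrow> nat" and F' \<epsilon> where
    m: "\<And>i. 0 < m i" and \<sigma>: "\<And>i g. \<sigma> i g permutes {..<m i}" and F'mono: "\<And>i. F' i \<subseteq> F' (Suc i)"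
    and F'un: "(\<Union>i. F' i) = UNIV" and \<epsilon>: "\<epsilon> \<longlonglongrightarrow> 0"
    and good: "\<And>i. real (card (sofic_good_set (\<sigma> i) (m i) (F' i))) \<ge> (1 - \<epsilon> i) * real (m i)"
    using sofic unfolding sofic_def by blast
  \<comment> \<open>\<open>S\<close> holds the coordinates read when decoding at the identity: the
    identity itself and all that \<open>a\<close> reads from the translates in
    \<open>F\<close>.\<close>
  define S where "S = {0} \<union> (\<lambda>(g, h). g + h) ` (F \<times> W)"
  have S: "finite S" using F W by (simp add: S_def)
  define E1 where "E1 = uminus ` (W \<union> F \<union> S)"
  have E1: "finite E1" using F W S by (simp add: E1_def)
  have "\<exists>i0. E1 \<subseteq> F' i0"
    using E1
  proof (induction rule: finite_induct)
    case (insert g E)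
    then obtain i where "E \<subseteq> F' i" by blast
    moreover obtain j where "g \<in> F' j" using F'un by blast
    moreover have "F' i \<subseteq> F' (max i j)" "F' j \<subseteq> F' (max i j)"
      using lift_Suc_mono_le[of F', OF F'mono] by simp_all
    ultimately show ?case by (intro exI[of _ "max i j"]) blast
  qed simp
  then obtain i0 where i0: "E1 \<subseteq> F' i0" ..
  \<comment> \<open>This threshold yields both \<open>\<epsilon> i \<le> 1/2\<close>, so that at
    least half of the vertices are good, and \<open>\<epsilon> i * L \<le> 1/2\<close>, so that the
    bad ones cost little.\<close>
  have "\<forall>\<^sub>F i in sequentially. \<epsilon> i < 1 / (2 * (L + 1))"
    using \<epsilon> L0 by (intro order_tendstoD(2)) auto
  then obtain i1 where i1: "\<And>i. i \<ge> i1 \<Longrightarrow> \<epsilon> i < 1 / (2 * (L + 1))"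
    by (auto simp: eventually_sequentially)
  define i where "i = max i0 i1"
  have E1F: "E1 \<subseteq> F' i" using i0 lift_Suc_mono_le[of F' i0 i, OF F'mono] by (auto simp: i_def)
  have \<epsilon>i: "\<epsilon> i < 1 / (2 * (L + 1))" by (rule i1) (simp add: i_def)
  define I where "I = {..<m i}"
  define V where "V = sofic_good_set (\<sigma> i) (m i) (F' i)"
  have VI: "V \<subseteq> I" by (auto simp: V_def I_def sofic_good_set_def)
  have I: "finite I" by (simp add: I_def)
  have V: "finite V" using VI I by (rule finite_subset)
  \<comment> \<open>The inverse makes the maps compose in the order of \<open>shift\<close>: as
    \<open>shift (- g) x h = x (g + h)\<close>, moving by \<open>g\<close> and then by
    \<open>h\<close> must lead to the vertex for \<open>g + h\<close>.\<close>
  define \<tau> where "\<tau> v g = \<sigma> i (- g) v" for v g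
  have \<tau>I: "\<tau> v g \<in> I" if "v \<in> I" for v g
    using permutes_in_image[OF \<sigma>] that by (simp add: \<tau>_def I_def)
  have \<sigma>inj: "\<sigma> i g v = \<sigma> i g w \<longleftrightarrow> v = w" for g v w
    using permutes_inj[OF \<sigma>] by (auto simp: inj_def)
  have good_mult: "\<sigma> i f1 (\<sigma> i f2 v) = \<sigma> i (f1 + f2) v" if "v \<in> V" "f1 \<in> F' i" "f2 \<in> F' i" for v f1 f2
    using that unfolding V_def sofic_good_set_def by blast
  have good_inj: "f1 = f2" if "v \<in> V" "f1 \<in> F' i" "f2 \<in> F' i" "\<sigma> i f1 v = \<sigma> i f2 v" for v f1 f2
    using that unfolding V_def sofic_good_set_def by blast
  have inj: "inj_on (\<tau> v) (W \<union> F \<union> S)" if "v \<in> V" for v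
  proof (rule inj_onI)
    fix g h assume gh: "g \<in> W \<union> F \<union> S" "h \<in> W \<union> F \<union> S" "\<tau> v g = \<tau> v h"
    then have "- g \<in> F' i" "- h \<in> F' i" using E1F by (auto simp: E1_def)
    then have "- g = - h" using good_inj[OF that, of "- g" "- h"] gh(3) by (simp add: \<tau>_def)
    then show "g = h" by simp
  qed
  \<comment> \<open>Goodness gives that applying \<open>\<sigma> i 0\<close> twice at
    \<open>v\<close> equals applying it once; injectivity cancels one application.\<close>
  have \<tau>0: "\<tau> v 0 = v" if "v \<in> V" for v
  proof -
    have "0 \<in> F' i" using E1F by (force simp: E1_def S_def)
    then have "\<sigma> i 0 (\<sigma> i 0 v) = \<sigma> i (0 + 0) v" by (intro good_mult that)
    then show ?thesis by (simp add: \<tau>_def \<sigma>inj)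
  qed
  have \<tau>mult: "\<tau> (\<tau> v g) h = \<tau> v (g + h)" if "v \<in> V" "g \<in> F" "h \<in> W" for v g h
  proof -
    have "- g \<in> F' i" "- h \<in> F' i" using E1F that by (auto simp: E1_def)
    then have "\<sigma> i (- h) (\<sigma> i (- g) v) = \<sigma> i (- h + - g) v"
      by (intro good_mult that(1))
    then show ?thesis by (simp add: \<tau>_def minus_add)
  qed
  define P where "P = PiM I (\<lambda>_. \<kappa>)"
  interpret P: prob_space P unfolding P_def by (intro prob_space_PiM \<kappa>)
  \<comment> \<open>The rule is applied at bad vertices too. Their windows may have collisions, but
    the code length is still at most \<open>L\<close>.\<close>
  define b where "b w x = a (\<lambda>h. x (\<tau> w h))" for w and x :: "nat \<Rightarrow> 'k"
  have pull: "(\<lambda>x. \<lambda>h. x (\<tau> w h)) \<in> measurable P M" if "w \<in> I" for w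
    unfolding P_def M_def using \<tau>I[OF that] sp
    by (intro measurable_PiM_single' measurable_component_singleton) auto
  have bm: "b w \<in> measurable P (count_space UNIV)" if "w \<in> I" for w
    unfolding b_def using measurable_compose[OF pull[OF that] a] .
  have bn: "b w x \<le> n" for w x by (simp add: b_def an)
  define \<Psi> where "\<Psi> v s = \<Phi> (\<lambda>g\<in>F. s (\<tau> v g))" for v and s :: "nat \<Rightarrow> nat"
  have main: "card V * (\<integral>k. - ln (r (\<beta> k)) \<partial>\<kappa>) \<le> (\<Sum>w\<in>I. \<integral>x. - ln (p (b w x)) \<partial>P) + card V * ln 2 +
     ln (2 * N) * (\<Sum>v\<in>V. measure P {x\<in>space P. \<beta> (x v) \<noteq> \<Psi> v (\<lambda>w\<in>I. b w x)})"
    unfolding P_def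
    by (rule iid_coding_inequality[OF \<kappa> I VI \<beta> \<beta>N r]) (use p psum bm bn in \<open>auto simp: P_def\<close>)
  \<comment> \<open>Reading the labels through \<open>\<tau> v\<close> turns the decoding error at
    \<open>v\<close> into the decoding error at the identity, an event that depends on
    \<open>S\<close> only.\<close>
  have prob_err: "measure P {x\<in>space P. \<beta> (x v) \<noteq> \<Psi> v (\<lambda>w\<in>I. b w x)}
      = measure M {x. \<beta> (x 0) \<noteq> \<Phi> (\<lambda>g\<in>F. a (shift (- g) x))}" if v: "v \<in> V" for v
  proof -
    let ?E = "{x. \<beta> (x 0) \<noteq> \<Phi> (\<lambda>g\<in>F. a (shift (- g) x))}"
    have vI: "v \<in> I" using v VI by blast
    have eq: "(\<lambda>h. x (\<tau> v h)) \<in> ?E \<longleftrightarrow> \<beta> (x v) \<noteq> \<Psi> v (\<lambda>w\<in>I. b w x)" for x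
    proof -
      have "(\<lambda>g\<in>F. a (shift (- g) (\<lambda>h. x (\<tau> v h)))) = (\<lambda>g\<in>F. (\<lambda>w\<in>I. b w x) (\<tau> v g))"
      proof (rule restrict_ext)
        fix g assume "g \<in> F"
        then have "a (shift (- g) (\<lambda>h. x (\<tau> v h))) = a (\<lambda>h. x (\<tau> (\<tau> v g) h))"
          by (intro aW) (simp add: shift_def \<tau>mult[OF v])
        then show "a (shift (- g) (\<lambda>h. x (\<tau> v h))) = (\<lambda>w\<in>I. b w x) (\<tau> v g)"
          using \<tau>I[OF vI] by (simp add: b_def)
      qed
      then show ?thesis by (simp add: \<Psi>_def \<tau>0[OF v])
    qed
    have dep: "indicator ?E y = (indicator ?E z :: real)" if yz: "\<And>h. h \<in> S \<Longrightarrow> y h = z h" for y z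
    proof -
      have "y 0 = z 0" by (rule yz) (simp add: S_def)
      moreover have "(\<lambda>g\<in>F. a (shift (- g) y)) = (\<lambda>g\<in>F. a (shift (- g) z))"
      proof (intro restrict_ext aW ballI)
        fix g h assume "g \<in> F" "h \<in> W"
        then have "g + h \<in> S" by (force simp: S_def)
        then show "shift (- g) y h = shift (- g) z h" by (simp add: shift_def yz)
      qed
      ultimately show ?thesis by (simp add: indicator_def)
    qed
    have "measure P {x\<in>space P. \<beta> (x v) \<noteq> \<Psi> v (\<lambda>w\<in>I. b w x)}
        = (\<integral>x. indicator {x\<in>space P. \<beta> (x v) \<noteq> \<Psi> v (\<lambda>w\<in>I. b w x)} x \<partial>P)"
      by (simp add: Int_def conj_commute)
    also have "\<dots> = (\<integral>x. indicator ?E (\<lambda>h. x (\<tau> v h)) \<partial>P)"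
      by (intro Bochner_Integration.integral_cong refl) (simp add: indicator_def eq[simplified])
    also have "\<dots> = (\<integral>x. indicator ?E x \<partial>M)"
      unfolding P_def M_def
    proof (rule bernoulli_window_pullback[OF \<kappa> sp _ _ _ dep])
      show "inj_on (\<tau> v) S" using inj[OF v] by (rule inj_on_subset) auto
      show "\<tau> v h \<in> I" for h by (rule \<tau>I[OF vI])
      show "indicator ?E \<in> borel_measurable (PiM UNIV (\<lambda>_. \<kappa>))"
        using EM unfolding M_def by (rule borel_measurable_indicator)
    qed
    also have "\<dots> = measure M ?E" by (simp add: spM)
    finally show ?thesis .
  qed
  have code_cost: "(\<Sum>w\<in>I. \<integral>x. - ln (p (b w x)) \<partial>P) \<le> card V * h + (m i - card V) * L"
  proof -
    have "(\<integral>x. - ln (p (b w x)) \<partial>P) \<le> h" if w: "w \<in> V" for w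
    proof -
      have wI: "w \<in> I" using w VI by blast
      have "(\<integral>x. - ln (p (b w x)) \<partial>P) = (\<integral>x. - ln (p (a x)) \<partial>M)"
        unfolding b_def P_def M_def
      proof (rule bernoulli_window_pullback[OF \<kappa> sp])
        show "inj_on (\<tau> w) W" using inj[OF w] by (rule inj_on_subset) auto
        show "\<tau> w h \<in> I" for h by (rule \<tau>I[OF wI])
        show "(\<lambda>x. - ln (p (a x))) \<in> borel_measurable (PiM UNIV (\<lambda>_. \<kappa>))"
          using measurable_compose[OF a, of "\<lambda>j. - ln (p j)" borel] by (simp add: M_def)
        show "- ln (p (a y)) = - ln (p (a z))" if "\<And>h. h \<in> W \<Longrightarrow> y h = z h" for y z
          using aW[of y z] that by simp
      qed
      then show ?thesis using ent by simp
    qed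
    moreover have "(\<integral>x. - ln (p (b w x)) \<partial>P) \<le> L" if w: "w \<in> I" for w
    proof -
      have "(\<integral>x. - ln (p (b w x)) \<partial>P) \<le> (\<integral>x. L \<partial>P)"
      proof (rule Bochner_Integration.integral_mono)
        show "integrable P (\<lambda>x. - ln (p (b w x)))"
          using integral_finite_range(1)[OF P.finite_measure_axioms bm[OF w], of "Suc n" "\<lambda>j. - ln (p j)"] bn
          by (simp add: less_Suc_eq_le)
        show "- ln (p (b w x)) \<le> L" for x by (rule L[OF bn])
      qed simp
      then show ?thesis by (simp add: P.prob_space)
    qed
    ultimately have "(\<Sum>w\<in>V. \<integral>x. - ln (p (b w x)) \<partial>P) + (\<Sum>w\<in>I - V. \<integral>x. - ln (p (b w x)) \<partial>P)
       \<le> (\<Sum>w\<in>V. h) + (\<Sum>w\<in>I - V. L)"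
      by (intro add_mono sum_mono) auto
    moreover have "(\<Sum>w\<in>I. \<integral>x. - ln (p (b w x)) \<partial>P) =
        (\<Sum>w\<in>V. \<integral>x. - ln (p (b w x)) \<partial>P) + (\<Sum>w\<in>I - V. \<integral>x. - ln (p (b w x)) \<partial>P)"
      using sum.subset_diff[OF VI I] by (simp add: add.commute)
    moreover have "card (I - V) = m i - card V" using card_Diff_subset[OF V VI] by (simp add: I_def)
    ultimately show ?thesis by simp
  qed
  \<comment> \<open>The bad vertices together cost at most half of \<open>m i\<close>, hence at most
    1 per good vertex.\<close>
  have bad: "(m i - card V) * L \<le> card V" and V0: "card V > 0"
  proof -
    have cVm: "card V \<le> m i" using card_mono[OF I VI] by (simp add: I_def)
    have m0: "real (m i) > 0" using m by simp
    have g: "(1 - \<epsilon> i) * m i \<le> card V" using good[of i] by (simp add: V_def)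
    have e1: "\<epsilon> i * (2 * (L + 1)) < 1" using \<epsilon>i L0 by (simp add: field_simps)
    have e2: "\<epsilon> i \<le> 1/2"
    proof (rule ccontr)
      assume "\<not> ?thesis"
      then have "1/2 * (2 * (L + 1)) \<le> \<epsilon> i * (2 * (L + 1))" using L0 by (intro mult_right_mono) auto
      then have "1/2 * (2 * (L + 1)) < 1" using e1 by (rule le_less_trans)
      then show False using L0 by simp
    qed
    have e3: "\<epsilon> i * L \<le> 1/2"
    proof (cases "\<epsilon> i \<ge> 0")
      case True then show ?thesis using e1 by (simp add: algebra_simps)
    next
      case False then show ?thesis using L0 mult_nonpos_nonneg[of "\<epsilon> i" L] by simp
    qed
    have half: "1/2 * m i \<le> card V"
      using g mult_right_mono[of "1/2" "1 - \<epsilon> i" "real (m i)"] e2 m0 by linarith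
    then show "card V > 0" using m0 by (cases "card V") auto
    have "real (m i) - card V \<le> \<epsilon> i * m i" using g by (simp add: algebra_simps)
    then have "(real (m i) - card V) * L \<le> (\<epsilon> i * m i) * L" using L0 by (rule mult_right_mono)
    also have "\<dots> = (\<epsilon> i * L) * m i" by simp
    also have "\<dots> \<le> 1/2 * m i" using e3 m0 by (intro mult_right_mono) auto
    finally show "(m i - card V) * L \<le> card V" using half cVm by (simp add: of_nat_diff)
  qed
  have "(\<Sum>v\<in>V. measure P {x\<in>space P. \<beta> (x v) \<noteq> \<Psi> v (\<lambda>w\<in>I. b w x)})
      = card V * measure M {x. \<beta> (x 0) \<noteq> \<Phi> (\<lambda>g\<in>F. a (shift (- g) x))}"
    using prob_err by simp
  then have "ln (2 * N) * (\<Sum>v\<in>V. measure P {x\<in>space P. \<beta> (x v) \<noteq> \<Psi> v (\<lambda>w\<in>I. b w x)}) \<le> card V * c"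
    using mult_left_mono[OF err, of "real (card V)"] by (simp add: mult.left_commute)
  with main code_cost bad
  have "card V * (\<integral>k. - ln (r (\<beta> k)) \<partial>\<kappa>) \<le> card V * h + card V + card V * ln 2 + card V * c"
    by linarith
  also have "\<dots> = card V * (h + c + ln 2 + 1)" by (simp add: algebra_simps)
  finally show ?thesis using V0 by (rule mult_left_le_imp_le[OF _ of_nat_0_less_iff[THEN iffD2]])
qed

section \<open>Contradiction between a base labelling of large entropy and the coding bound\<close>

theorem theorem1p7:
  fixes \<kappa> :: "'k::polish_space measure"
  assumes "sofic TYPE('g::{group_add, countable})"
    and "has_nonabelian_free_subgroup TYPE('g)"
    and "prob_space \<kappa>"
    and "sets \<kappa> = sets borel"
    and "measure_entropy \<kappa> = \<infinity>"
  shows "\<not> (\<exists>\<alpha>. is_partition (bernoulli (UNIV :: 'g set) \<kappa>) \<alpha>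
               \<and> partition_entropy (bernoulli (UNIV :: 'g set) \<kappa>) \<alpha> < \<infinity>
               \<and> generating (bernoulli (UNIV :: 'g set) \<kappa>) (shift :: 'g \<Rightarrow> _) \<alpha>)"
proof
  assume "\<exists>\<alpha>. is_partition (bernoulli (UNIV :: 'g set) \<kappa>) \<alpha>
               \<and> partition_entropy (bernoulli (UNIV :: 'g set) \<kappa>) \<alpha> < \<infinity>
               \<and> generating (bernoulli (UNIV :: 'g set) \<kappa>) (shift :: 'g \<Rightarrow> _) \<alpha>"
  then obtain \<alpha> where \<alpha>: "is_partition (PiM (UNIV :: 'g set) (\<lambda>_. \<kappa>)) \<alpha>"
    "partition_entropy (PiM (UNIV :: 'g set) (\<lambda>_. \<kappa>)) \<alpha> < \<infinity>"
    "generating (PiM (UNIV :: 'g set) (\<lambda>_. \<kappa>)) (shift :: 'g \<Rightarrow> _) \<alpha>"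
    unfolding bernoulli_def by blast
  have sp: "space \<kappa> = UNIV" using sets_eq_imp_space_eq[OF assms(4)] by simp
  have spM: "space (PiM (UNIV :: 'g set) (\<lambda>_. \<kappa>)) = UNIV" by (simp add: space_PiM sp)
  have pM: "prob_space (PiM (UNIV :: 'g set) (\<lambda>_. \<kappa>))" by (intro prob_space_PiM assms(3))
  obtain idx H where idx: "idx \<in> measurable (PiM (UNIV :: 'g set) (\<lambda>_. \<kappa>)) (count_space UNIV)"
    "\<forall>A\<in>\<alpha>. \<exists>j::nat. A = {x. idx x = j}"
    and H: "\<forall>n. (\<Sum>j<n. - measure (PiM (UNIV :: 'g set) (\<lambda>_. \<kappa>)) {x. idx x = j} *
        ln (measure (PiM (UNIV :: 'g set) (\<lambda>_. \<kappa>)) {x. idx x = j})) \<le> (H::real)"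
    using finite_entropy_partition_index[OF pM spM \<alpha>(1,2)] by (elim exE conjE) (rule that)
  \<comment> \<open>The threshold is the upper bound of the coding argument: code length
    \<open>H + ln 4 + 1\<close>, decoding errors 2, guessing \<open>ln 2\<close>, bad vertices 1. It
    depends on \<open>H\<close> alone, so \<beta> can be chosen before the code.\<close>
  obtain N \<beta> r where \<beta>: "\<beta> \<in> measurable \<kappa> (count_space UNIV)" "\<forall>x. \<beta> x < N"
    and r: "\<forall>j. 0 < r j \<and> r j \<le> (1::real) \<and> measure \<kappa> {x\<in>space \<kappa>. \<beta> x = (j::nat)} \<le> r j"
    and large: "(\<integral>x. - ln (r (\<beta> x)) \<partial>\<kappa>) > (H + ln 4 + 1) + 2 + ln 2 + 1"
    using infinite_measure_entropy_imp_large_labelling[OF assms(3-5), of "(H + ln 4 + 1) + 2 + ln 2 + 1"]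
    by (elim exE conjE) (rule that)
  obtain n and p :: "nat \<Rightarrow> real" and a W F and \<Phi> :: "('g \<Rightarrow> nat) \<Rightarrow> nat" where code:
    "finite W" "finite F" "a \<in> measurable (PiM (UNIV :: 'g set) (\<lambda>_. \<kappa>)) (count_space UNIV)"
    "\<forall>x. a x \<le> n" "\<forall>x y. (\<forall>h\<in>W. x h = y h) \<longrightarrow> a x = a y"
    "\<forall>j. 0 < p j \<and> p j \<le> 1" "(\<Sum>j\<le>n. p j) \<le> 1"
    "(\<integral>x. - ln (p (a x)) \<partial>PiM (UNIV :: 'g set) (\<lambda>_. \<kappa>)) \<le> H + ln 4 + 1"
    "{x. \<beta> (x 0) \<noteq> \<Phi> (\<lambda>g\<in>F. a (shift (- g) x))} \<in> sets (PiM (UNIV :: 'g set) (\<lambda>_. \<kappa>))"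
    "ln (2 * N) * measure (PiM (UNIV :: 'g set) (\<lambda>_. \<kappa>))
       {x. \<beta> (x 0) \<noteq> \<Phi> (\<lambda>g\<in>F. a (shift (- g) x))} \<le> 2"
    using finite_entropy_generator_local_code[OF assms(3) sp \<alpha>(3) idx
        H[rule_format] \<beta>(1) \<beta>(2)[rule_format]]
    by (elim exE conjE) (rule that)
  from sofic_local_code_bound[OF assms(1,3) sp \<beta>(1) \<beta>(2)[rule_format] r[rule_format]
      code(1-3) code(4)[rule_format] code(5)[rule_format] code(6)[rule_format] code(7-)] large show False by simp
qed

end
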